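(* Let $h$ be an orientation-preserving circle homeomorphism fixing $-1,\mathrm i,1$ with finitely many nonzero shears (i.e. $s_h$ has finite support). The following are equivalent: (i) $h$ is Weil--Petersson; (ii) $h$ is $\mathcal C^{1,1}$ with rational breakpoints (i.e. $h\in\mathcal C^{1,1}$ and $h$ is piecewise Möbius with breakpoints in $V$); (iii) $s=s_h$ satisfies the finite balanced condition.
   Context: Farey tessellation: $\mathbb D$ is the unit disk with its hyperbolic metric, $\mathbb T=\partial\mathbb D$, and $(a,b)$ denotes the unoriented hyperbolic geodesic with endpoints $a\ne b\in\mathbb T$. The Farey tessellation $\mathfrak F$ is the ideal triangulation of $\mathbb D$ obtained from the ideal triangle with vertices $1,\mathrm i,-1$ by repeated hyperbolic reflections across edges; $V$ (the rational points $\mathbb Q^2\cap\mathbb T$) is its vertex set, $E$ its edge set. For $e\in E$, $Q_e$ is the union of the two triangles of $\mathfrak F$ having $e$ as an edge, with vertices $(a,b,c,d)$ counterclockwise, $e=(a,c)$. $\mathrm{fan}(v)$ is the set of edges of $E$ incident to $v\in V$. Shears: $s_h(e)=\log\mathrm{cr}(h(a),h(b),h(c),h(d))$ where $Q_e=(a,b,c,d)$, $e=(a,c)$, $\mathrm{cr}(a,b,c,d)=\frac{(b-a)(d-c)}{(c-b)(d-a)}$. Finite balanced condition for $s:E\to\mathbb R$: for every $v\in V$, only finitely many $e\in\mathrm{fan}(v)$ have $s(e)\ne0$, and $\sum_{e\in\mathrm{fan}(v)}s(e)=0$. Piecewise Möbius with breakpoints in $V$: there are finitely many $v_1,\dots,v_k\in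 V$ in counterclockwise order such that $h$ restricted to each closed arc from $v_i$ to $v_{i+1}$ (cyclically) is the restriction of an element of $\mathrm{PSU}(1,1)$. $\mathcal C^{1,1}$ is the class of circle homeomorphisms with $\log h'$ Lipschitz. $h$ is Weil--Petersson if it is absolutely continuous with respect to arclength and $\log h'$ (derivative with respect to arclength) is in $H^{1/2}(\mathbb T)$, i.e. $\iint_{\mathbb T\times\mathbb T}\left|\frac{\log h'(\zeta)-\log h'(\xi)}{\zeta-\xi}\right|^2|d\zeta||d\xi|<\infty$. *)

theory Defs
  imports "HOL-Analysis.Analysis"
begin

section \<open>Circle homeomorphisms\<close>

abbreviation unit_circle :: "complex set" where
  "unit_circle \<equiv> sphere 0 1"

definition ccw :: "complex list \<Rightarrow> bool" where
  "ccw zs \<longleftrightarrow> (\<exists>ts. zs = map cis ts \<and> sorted_wrt (<) ts \<and> (\<forall>t\<in>set ts. t < hd ts + 2 * pi))"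

text \<open>A circle map is an arbitrary function on the complex plane; only its values on the
  unit circle are relevant.\<close>

definition circle_homeo :: "(complex \<Rightarrow> complex) \<Rightarrow> bool" where
  "circle_homeo h \<longleftrightarrow> (\<exists>g. homeomorphism unit_circle unit_circle h g)"

definition orientation_preserving :: "(complex \<Rightarrow> complex) \<Rightarrow> bool" where
  "orientation_preserving h \<longleftrightarrow> (\<forall>a b c. ccw [a, b, c] \<longrightarrow> ccw [h a, h b, h c])"


section \<open>The Farey tessellation\<close>

text \<open>Hyperbolic geodesics and ideal triangles of the unit disk are represented by the sets of
  their ideal endpoints and ideal vertices. The reflection of the closed disk across the geodesic
  with endpoints \<open>a\<close> and \<open>b\<close> is the Euclidean inversion in the circle orthogonal to the unit circle
  at \<open>a\<close> and \<open>b\<close>, which has centre \<open>2ab/(a + b)\<close>; if \<open>a + b = 0\<close>, the formula gives the Euclidean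
  reflection across the diameter through \<open>a\<close>.\<close>

definition hyp_reflection :: "complex \<Rightarrow> complex \<Rightarrow> complex \<Rightarrow> complex" where
  "hyp_reflection a b z = (2 * a * b * cnj z - (a + b)) / ((a + b) * cnj z - 2)"

inductive_set farey_triangles :: "complex set set" where
  base: "{1, \<i>, -1} \<in> farey_triangles"
| reflect: "\<lbrakk>T \<in> farey_triangles; a \<in> T; b \<in> T; a \<noteq> b\<rbrakk> \<Longrightarrow> hyp_reflection a b ` T \<in> farey_triangles"

definition farey_vertices :: "complex set" where
  "farey_vertices = \<Union> farey_triangles"

definition farey_edges :: "complex set set" where
  "farey_edges = {{a, b} | a b. a \<noteq> b \<and> (\<exists>T\<in>farey_triangles. a \<in> T \<and> b \<in> T)}"

definition fan :: "complex \<Rightarrow> complex set set" where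
  "fan v = {e \<in> farey_edges. v \<in> e}"

text \<open>\<open>farey_quad e a b c d\<close>: \<open>Q\<^sub>e = (a, b, c, d)\<close> and \<open>e = (a, c)\<close>. For given \<open>e\<close> this determines
  \<open>(a, b, c, d)\<close> up to the exchange with \<open>(c, d, a, b)\<close>, which preserves the cross-ratio.\<close>

definition farey_quad :: "complex set \<Rightarrow> complex \<Rightarrow> complex \<Rightarrow> complex \<Rightarrow> complex \<Rightarrow> bool" where
  "farey_quad e a b c d \<longleftrightarrow> e = {a, c} \<and> ccw [a, b, c, d] \<and>
     {a, b, c} \<in> farey_triangles \<and> {a, c, d} \<in> farey_triangles"


section \<open>Shears\<close>

definition cross_ratio :: "complex \<Rightarrow> complex \<Rightarrow> complex \<Rightarrow> complex \<Rightarrow> complex" where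
  "cross_ratio a b c d = ((b - a) * (d - c)) / ((c - b) * (d - a))"

text \<open>The cross-ratio of four points of the circle in counterclockwise order is a positive real,
  so that taking the real part only changes the type.\<close>

definition shear :: "(complex \<Rightarrow> complex) \<Rightarrow> complex set \<Rightarrow> real" where
  "shear h e = (THE s. \<exists>a b c d. farey_quad e a b c d \<and>
                         s = ln (Re (cross_ratio (h a) (h b) (h c) (h d))))"

text \<open>The sum runs over the support because \<open>sum\<close> vanishes on infinite index sets.\<close>

definition finite_balanced :: "(complex set \<Rightarrow> real) \<Rightarrow> bool" where
  "finite_balanced s \<longleftrightarrow> (\<forall>v\<in>farey_vertices.
     finite {e \<in> fan v. s e \<noteq> 0} \<and> (\<Sum>e\<in>{e \<in> fan v. s e \<noteq> 0}. s e) = 0)"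


section \<open>Piecewise Moebius homeomorphisms\<close>

definition PSU11 :: "(complex \<Rightarrow> complex) set" where
  "PSU11 = {\<lambda>z. (\<alpha> * z + \<beta>) / (cnj \<beta> * z + cnj \<alpha>) | \<alpha> \<beta>. (norm \<alpha>)\<^sup>2 - (norm \<beta>)\<^sup>2 = 1}"

text \<open>The closed arc from \<open>a\<close> counterclockwise to \<open>b\<close>; for \<open>a = b\<close> it is the whole circle.\<close>

definition closed_arc :: "complex \<Rightarrow> complex \<Rightarrow> complex set" where
  "closed_arc a b = {a * cis t | t s. 0 \<le> t \<and> t \<le> s \<and> 0 < s \<and> s \<le> 2 * pi \<and> b = a * cis s}"

definition piecewise_Moebius :: "complex set \<Rightarrow> (complex \<Rightarrow> complex) \<Rightarrow> bool" where
  "piecewise_Moebius B h \<longleftrightarrow> (\<exists>vs. vs \<noteq> [] \<and> set vs \<subseteq> B \<and> ccw vs \<and>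
     (\<forall>i<length vs. \<exists>g\<in>PSU11.
        \<forall>z\<in>closed_arc (vs ! i) (vs ! (Suc i mod length vs)). h z = g z))"


section \<open>Regularity classes\<close>

text \<open>Since \<open>t \<mapsto> \<zeta> * cis t\<close> is the arclength parametrisation of the circle starting at \<open>\<zeta>\<close>, and
  \<open>\<i> * h \<zeta>\<close> is the counterclockwise unit tangent vector at \<open>h \<zeta>\<close>, the real number \<open>d\<close> is the
  derivative of \<open>h\<close> at \<open>\<zeta>\<close> with respect to arclength.\<close>

definition has_arc_derivative :: "(complex \<Rightarrow> complex) \<Rightarrow> real \<Rightarrow> complex \<Rightarrow> bool" where
  "has_arc_derivative h d \<zeta> \<longleftrightarrow>
     ((\<lambda>t. h (\<zeta> * cis t)) has_vector_derivative (of_real d * (\<i> * h \<zeta>))) (at 0)"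

definition arc_deriv :: "(complex \<Rightarrow> complex) \<Rightarrow> complex \<Rightarrow> real" where
  "arc_deriv h \<zeta> = (THE d. has_arc_derivative h d \<zeta>)"

text \<open>As \<open>ln\<close> is total, positivity of the derivative is required explicitly wherever
  \<open>ln (arc_deriv h \<zeta>)\<close> is used (everywhere here, almost everywhere below).\<close>

definition C11_homeo :: "(complex \<Rightarrow> complex) \<Rightarrow> bool" where
  "C11_homeo h \<longleftrightarrow> circle_homeo h \<and>
     (\<forall>\<zeta>\<in>unit_circle. \<exists>d>0. has_arc_derivative h d \<zeta>) \<and>
     (\<exists>L. L-lipschitz_on unit_circle (\<lambda>\<zeta>. ln (arc_deriv h \<zeta>)))"

text \<open>The finitely many non-overlapping subintervals of an interval \<open>S\<close> in the usual
  \<open>\<epsilon>\<close>-\<open>\<delta>\<close>-definition are given as a division of their union.\<close>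

definition abs_continuous_on :: "real set \<Rightarrow> (real \<Rightarrow> 'a::metric_space) \<Rightarrow> bool" where
  "abs_continuous_on S f \<longleftrightarrow> (\<forall>\<epsilon>>0. \<exists>\<delta>>0. \<forall>\<D> U. \<D> division_of U \<and> U \<subseteq> S \<and>
     (\<Sum>K\<in>\<D>. Sup K - Inf K) < \<delta> \<longrightarrow> (\<Sum>K\<in>\<D>. dist (f (Inf K)) (f (Sup K))) < \<epsilon>)"

definition H_half :: "(complex \<Rightarrow> real) \<Rightarrow> bool" where
  "H_half u \<longleftrightarrow> (\<lambda>t. u (cis t)) \<in> borel_measurable lebesgue \<and>
     (\<integral>\<^sup>+x\<in>{0..2*pi}. (\<integral>\<^sup>+y\<in>{0..2*pi}.
        ennreal ((norm (of_real (u (cis x) - u (cis y)) / (cis x - cis y)))\<^sup>2) \<partial>lebesgue) \<partial>lebesgue) < \<infinity>"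

definition weil_petersson :: "(complex \<Rightarrow> complex) \<Rightarrow> bool" where
  "weil_petersson h \<longleftrightarrow> abs_continuous_on {0..2*pi} (\<lambda>t. h (cis t)) \<and>
     (AE t in lebesgue. \<exists>d>0. has_arc_derivative h d (cis t)) \<and>
     H_half (\<lambda>\<zeta>. ln (arc_deriv h \<zeta>))"


section \<open>The vertices of the tessellation are the rational points of the circle\<close>

text \<open>\<open>rpt p q\<close> is the image of the extended rational number \<open>p/q\<close> under the Cayley transform taking
  \<open>\<infinity>, 1, 0\<close> to \<open>1, \<i>, -1\<close>. The Farey triangles are the images of the triangles with vertices
  \<open>p/q\<close>, \<open>r/s\<close> and \<open>(p + r)/(q + s)\<close>, where \<open>ps - qr\<close> is \<open>1\<close> or \<open>-1\<close>.\<close>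

definition rpt :: "int \<Rightarrow> int \<Rightarrow> complex" where
  "rpt p q = Complex (of_int p) (of_int q) / Complex (of_int p) (- of_int q)"

lemma rpt_minus: "rpt (- p) (- q) = rpt p q"
proof -
  have "Complex (of_int (- p)) (of_int (- q)) = - Complex (of_int p) (of_int q)"
    "Complex (of_int (- p)) (- of_int (- q)) = - Complex (of_int p) (- of_int q)"
    by (simp_all add: complex_eq_iff)
  then show ?thesis by (simp add: rpt_def del: of_int_minus)
qed

lemma moeb_aux:
  fixes w v w' v' :: complex
  assumes "w \<noteq> 0" "v \<noteq> 0" "w' \<noteq> 0" "v' \<noteq> 0" "w + v \<noteq> 0" "w' + v' \<noteq> 0" "w' - v' \<noteq> 0" "v * w' - w * v' \<noteq> 0"
  shows "(2 * (w / w') * (v / v') * ((w' + v') / (w + v)) - (w / w' + v / v')) /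
     ((w / w' + v / v') * ((w' + v') / (w + v)) - 2) = (w - v) / (w' - v')"
proof -
  have n': "2 * (w / w') * (v / v') * (S' / S) - (w / w' + v / v') =
      (2 * w * v * S' - (w * v' + v * w') * S) / (w' * v' * S)"
    and d': "(w / w' + v / v') * (S' / S) - 2 = ((w * v' + v * w') * S' - 2 * w' * v' * S) / (w' * v' * S)"
    if "S \<noteq> 0" for S S'
    using assms that by (simp_all add: field_simps)
  have n: "2 * (w / w') * (v / v') * ((w' + v') / (w + v)) - (w / w' + v / v') =
    (w - v) * (v * w' - w * v') / (w' * v' * (w + v))"
    unfolding n'[OF assms(5)] by (rule arg_cong2[where f="(/)"]) (simp_all add: algebra_simps)
  have d: "(w / w' + v / v') * ((w' + v') / (w + v)) - 2 = (w' - v') * (v * w' - w * v') / (w' * v' * (w + v))"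
    unfolding d'[OF assms(5)] by (rule arg_cong2[where f="(/)"]) (simp_all add: algebra_simps)
  show ?thesis unfolding n d using assms by simp
qed

lemma hyp_reflection_rpt:
  assumes "\<bar>p * s - q * r\<bar> = 1"
  shows "hyp_reflection (rpt p q) (rpt r s) (rpt (p + r) (q + s)) = rpt (p - r) (q - s)"
    and "hyp_reflection (rpt p q) (rpt r s) (rpt p q) = rpt p q"
    and "hyp_reflection (rpt p q) (rpt r s) (rpt r s) = rpt r s"
    and "rpt p q \<noteq> rpt r s"
proof -
  define w v where "w = Complex (of_int p) (of_int q)" and "v = Complex (of_int r) (of_int s)"
  have z: "rpt p q = w / cnj w" "rpt r s = v / cnj v"
    "rpt (p + r) (q + s) = (w + v) / (cnj w + cnj v)"
    "rpt (p - r) (q - s) = (w - v) / (cnj w - cnj v)"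
    unfolding rpt_def w_def v_def
    by (rule arg_cong2[where f="(/)"]; simp add: complex_eq_iff)+
  have ne: "w \<noteq> 0" "v \<noteq> 0" "w + v \<noteq> 0" "w - v \<noteq> 0"
  proof -
    have "\<not> (p = 0 \<and> q = 0)" "\<not> (r = 0 \<and> s = 0)" using assms by auto
    moreover have "\<not> (p + r = 0 \<and> q + s = 0)"
    proof
      assume "p + r = 0 \<and> q + s = 0"
      then have "r = - p" "s = - q" by auto
      then show False using assms by simp
    qed
    moreover have "\<not> (p - r = 0 \<and> q - s = 0)" using assms by auto
    ultimately show "w \<noteq> 0" "v \<noteq> 0" "w + v \<noteq> 0" "w - v \<noteq> 0"
      by (auto simp: w_def v_def complex_eq_iff simp flip: of_int_add)
  qed
  have nec: "cnj w \<noteq> 0" "cnj v \<noteq> 0" "cnj w + cnj v \<noteq> 0" "cnj w - cnj v \<noteq> 0"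
    using ne by (simp_all flip: complex_cnj_add complex_cnj_diff)
  have "Im (v * cnj w - w * cnj v) = 2 * of_int (p * s - q * r)"
    by (simp add: w_def v_def algebra_simps)
  moreover have "p * s - q * r \<noteq> 0" using assms by auto
  ultimately have det: "v * cnj w - w * cnj v \<noteq> 0"
    by (metis mult_eq_0_iff of_int_eq_0_iff zero_complex.simps(2) zero_neq_numeral)
  show "hyp_reflection (rpt p q) (rpt r s) (rpt (p + r) (q + s)) = rpt (p - r) (q - s)"
    unfolding z hyp_reflection_def complex_cnj_divide complex_cnj_add complex_cnj_cnj
    using moeb_aux[OF ne(1,2) nec(1,2) ne(3) nec(3,4) det] by simp
  have e1: "2 * (w / cnj w) * (v / cnj v) * (cnj w / w) - (w / cnj w + v / cnj v) =
        (v * cnj w - w * cnj v) / (cnj w * cnj v)"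
    "(w / cnj w + v / cnj v) * (cnj w / w) - 2 = (v * cnj w - w * cnj v) / (w * cnj v)"
    "2 * (w / cnj w) * (v / cnj v) * (cnj v / v) - (w / cnj w + v / cnj v) =
        (w * cnj v - v * cnj w) / (cnj w * cnj v)"
    "(w / cnj w + v / cnj v) * (cnj v / v) - 2 = (w * cnj v - v * cnj w) / (v * cnj w)"
    using ne nec by (simp_all add: field_simps)
  show "hyp_reflection (rpt p q) (rpt r s) (rpt p q) = rpt p q"
    unfolding z hyp_reflection_def complex_cnj_divide complex_cnj_add complex_cnj_cnj e1
    using ne nec det by simp
  have det': "w * cnj v - v * cnj w \<noteq> 0" using det by auto
  show "hyp_reflection (rpt p q) (rpt r s) (rpt r s) = rpt r s"
    unfolding z hyp_reflection_def complex_cnj_divide complex_cnj_add complex_cnj_cnj e1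
    using ne nec det' by simp
  show "rpt p q \<noteq> rpt r s" unfolding z using nec det by (auto simp: field_simps)
qed

definition ftri :: "int \<Rightarrow> int \<Rightarrow> int \<Rightarrow> int \<Rightarrow> complex set" where
  "ftri p q r s = {rpt p q, rpt r s, rpt (p + r) (q + s)}"

lemma hyp_reflection_commute: "hyp_reflection a b = hyp_reflection b a"
  by (auto simp: hyp_reflection_def mult_ac add_ac)

lemma ftri_reflect:
  assumes "\<bar>p * s - q * r\<bar> = 1"
  shows "hyp_reflection (rpt p q) (rpt r s) ` ftri p q r s = ftri p q (- r) (- s)"
  using hyp_reflection_rpt[OF assms] by (simp add: ftri_def rpt_minus)

lemma ftri_perm:
  shows "ftri p q r s = ftri r s p q" "ftri p q r s = ftri (- p) (- q) (p + r) (q + s)"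
    "ftri (- p) (- q) (- r) (- s) = ftri p q r s"
  using rpt_minus[of p q] rpt_minus[of r s] rpt_minus[of "p + r" "q + s"]
  by (auto simp: ftri_def add.commute)

lemma ftri_base: "ftri 1 0 0 1 = {1, \<i>, -1}"
proof -
  have "rpt 1 0 = 1" "rpt 0 1 = -1" "rpt 1 1 = \<i>"
    by (simp_all add: rpt_def complex_eq_iff Re_divide Im_divide power2_eq_square)
  then show ?thesis by (simp add: ftri_def insert_commute)
qed

lemma farey_triangles_ftri:
  assumes "T \<in> farey_triangles"
  shows "\<exists>p q r s. T = ftri p q r s \<and> \<bar>p * s - q * r\<bar> = 1"
  using assms
proof induction
  case base
  show ?case by (rule exI[of _ 1], rule exI[of _ 0], rule exI[of _ 0], rule exI[of _ 1])
      (simp add: ftri_base)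
next
  case (reflect T a b)
  then obtain p q r s where T: "T = ftri p q r s" and d: "\<bar>p * s - q * r\<bar> = 1" by blast
  have "\<exists>p q r s. T = ftri p q r s \<and> \<bar>p * s - q * r\<bar> = 1 \<and>
     hyp_reflection a b = hyp_reflection (rpt p q) (rpt r s)"
  proof -
    let ?P = "\<lambda>p q r s. T = ftri p q r s \<and> \<bar>p * s - q * r\<bar> = 1 \<and>
     hyp_reflection a b = hyp_reflection (rpt p q) (rpt r s)"
    consider "{a, b} = {rpt p q, rpt r s}" | "{a, b} = {rpt p q, rpt (p + r) (q + s)}"
      | "{a, b} = {rpt r s, rpt (p + r) (q + s)}"
      using reflect.hyps(2-4) T by (auto simp: ftri_def)
    then show ?thesis
    proof cases
      case 1
      then have "?P p q r s" using T d hyp_reflection_commute by (auto simp: doubleton_eq_iff)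
      then show ?thesis by blast
    next
      case 2
      then have "?P (- p) (- q) (p + r) (q + s)"
        using T d hyp_reflection_commute ftri_perm(2)[of p q r s]
        by (auto simp: doubleton_eq_iff rpt_minus algebra_simps)
      then show ?thesis by blast
    next
      case 3
      then have "?P (- r) (- s) (r + p) (s + q)"
        using T d hyp_reflection_commute ftri_perm(2)[of r s p q] ftri_perm(1)[of p q r s]
        by (auto simp: doubleton_eq_iff rpt_minus algebra_simps)
      then show ?thesis by blast
    qed
  qed
  then obtain p q r s where "T = ftri p q r s" "\<bar>p * s - q * r\<bar> = 1"
     "hyp_reflection a b = hyp_reflection (rpt p q) (rpt r s)" by blast
  then have "hyp_reflection a b ` T = ftri p q (- r) (- s) \<and> \<bar>p * (- s) - q * (- r)\<bar> = 1"
    using ftri_reflect by (simp add: abs_minus_commute)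
  then show ?case by blast
qed

lemma ftri_flip:
  assumes "ftri p q r s \<in> farey_triangles" "\<bar>p * s - q * r\<bar> = 1"
  shows "ftri p q (- r) (- s) \<in> farey_triangles"
  using farey_triangles.reflect[OF assms(1), of "rpt p q" "rpt r s"] hyp_reflection_rpt(4)[OF assms(2)]
    ftri_reflect[OF assms(2)] by (simp add: ftri_def)

lemma ftri_add:
  assumes "ftri p q r s \<in> farey_triangles" "\<bar>p * s - q * r\<bar> = 1"
  shows "ftri p q (p + r) (q + s) \<in> farey_triangles"
proof -
  have "ftri (- p) (- q) (p + r) (q + s) \<in> farey_triangles" using assms(1) ftri_perm(2) by simp
  then have "ftri (- p) (- q) (- (p + r)) (- (q + s)) \<in> farey_triangles"
    by (rule ftri_flip) (use assms(2) in \<open>simp add: algebra_simps abs_minus_commute\<close>)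
  then show ?thesis using ftri_perm(3) by metis
qed

lemma ftri_farey:
  "\<bar>p * s - q * r\<bar> = 1 \<Longrightarrow> ftri p q r s \<in> farey_triangles"
proof (induction "nat \<bar>q\<bar> + nat \<bar>s\<bar>" arbitrary: p q r s rule: less_induct)
  case less
  have flip: "\<bar>a * - d - b * - c\<bar> = (1::int)" if "\<bar>a * d - b * c\<bar> = 1" for a b c d
    using that by (simp add: abs_minus_commute)
  have swap: "\<bar>c * b - d * a\<bar> = (1::int)" if "\<bar>a * d - b * c\<bar> = 1" for a b c d
    using that by (simp add: abs_minus_commute mult.commute)
  have shift: "ftri a 0 c d \<in> farey_triangles" if "\<bar>a * d\<bar> = 1" for a c d :: int
  proof -
    have base: "ftri 1 0 0 1 \<in> farey_triangles" using farey_triangles.base ftri_base by simp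
    have pos: "ftri 1 0 (int n) 1 \<in> farey_triangles" for n
    proof (induction n)
      case (Suc n)
      show ?case using ftri_add[OF Suc] by (simp add: add.commute)
    qed (use base in simp)
    have neg: "ftri 1 0 (- int n) 1 \<in> farey_triangles" for n
    proof (induction n)
      case (Suc n)
      have "ftri 1 0 (int n) (- 1) \<in> farey_triangles" using ftri_flip[OF Suc] by simp
      then have "ftri 1 0 (1 + int n) (0 - 1) \<in> farey_triangles" using ftri_add by force
      then have "ftri 1 0 (- (1 + int n)) (- (0 - 1)) \<in> farey_triangles" by (rule ftri_flip) simp
      then show ?case by simp
    qed (use base in simp)
    have all1: "ftri 1 0 c 1 \<in> farey_triangles" for c
      by (cases c rule: int_cases2) (use pos neg in auto)
    have all: "ftri 1 0 c d \<in> farey_triangles" if "\<bar>d\<bar> = 1" for c d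
    proof (cases "d = 1")
      case False
      then have "d = -1" using that by linarith
      then show ?thesis using ftri_flip[OF all1[of "- c"]] by simp
    qed (use all1 in simp)
    have "\<bar>a\<bar> = 1 \<and> \<bar>d\<bar> = 1" using that zmult_eq_1_iff[of "\<bar>a\<bar>" "\<bar>d\<bar>"]
      unfolding abs_mult by linarith
    then consider "a = 1" "\<bar>d\<bar> = 1" | "a = -1" "\<bar>d\<bar> = 1" by linarith
    then show ?thesis
    proof cases
      case 2
      then show ?thesis using all[of "- d" "- c"] ftri_perm(3)[of 1 0 "- c" "- d"] by simp
    qed (use all in simp)
  qed
  have step: "ftri a b c d \<in> farey_triangles"
    if dt: "\<bar>a * d - b * c\<bar> = 1" and m: "nat \<bar>b\<bar> + nat \<bar>d\<bar> = nat \<bar>q\<bar> + nat \<bar>s\<bar>"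
      and nz: "b \<noteq> 0" "d \<noteq> 0" "\<bar>b\<bar> \<le> \<bar>d\<bar>" for a b c d
  proof -
    have red: "ftri x y (c - x) (d - y) \<in> farey_triangles \<and> ftri x y c d \<in> farey_triangles"
      if "x = a \<and> y = b \<or> x = - a \<and> y = - b" "\<bar>d - y\<bar> < \<bar>d\<bar>" for x y
    proof -
      have 1: "\<bar>x * (d - y) - y * (c - x)\<bar> = 1" using that(1) dt
        by (auto simp: algebra_simps abs_minus_commute)
      have "\<bar>y\<bar> = \<bar>b\<bar>" using that(1) by auto
      moreover have "nat \<bar>d - y\<bar> < nat \<bar>d\<bar>" using that(2) by simp
      ultimately have "nat \<bar>y\<bar> + nat \<bar>d - y\<bar> < nat \<bar>q\<bar> + nat \<bar>s\<bar>"
        unfolding m[symmetric] by simp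
      then have 2: "ftri x y (c - x) (d - y) \<in> farey_triangles"
        using 1 by (rule less.hyps)
      then show ?thesis using ftri_add[OF 2 1] by simp
    qed
    show ?thesis
    proof (cases "\<bar>d - b\<bar> < \<bar>d\<bar>")
      case True
      then show ?thesis using red[of a b] by blast
    next
      case False
      then have "\<bar>d - (- b)\<bar> < \<bar>d\<bar>" using nz by linarith
      then have "ftri (- a) (- b) c d \<in> farey_triangles" using red[of "- a" "- b"] by blast
      then have "ftri (- a) (- b) (- c) (- d) \<in> farey_triangles"
        by (rule ftri_flip) (use dt in \<open>simp add: abs_minus_commute\<close>)
      then show ?thesis using ftri_perm(3) by simp
    qed
  qed
  consider "q = 0" | "s = 0" | "q \<noteq> 0" "s \<noteq> 0" "\<bar>q\<bar> \<le> \<bar>s\<bar>" | "q \<noteq> 0" "s \<noteq> 0" "\<bar>s\<bar> \<le> \<bar>q\<bar>" by linarith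
  then show ?case
  proof cases
    case 1
    then show ?thesis using shift[of p s r] less.prems by simp
  next
    case 2
    then show ?thesis using shift[of r q p] less.prems ftri_perm(1)[of p q r s] by (simp add: mult.commute)
  next
    case 3
    then show ?thesis using step[of p s q r] less.prems by simp
  next
    case 4
    then have "ftri r s p q \<in> farey_triangles" using step[of r q s p] swap[OF less.prems] by simp
    then show ?thesis using ftri_perm(1) by simp
  qed
qed

lemma farey_vertices_eq: "farey_vertices = {z \<in> unit_circle. Re z \<in> \<rat> \<and> Im z \<in> \<rat>}"
proof (intro equalityI subsetI)
  fix z assume "z \<in> farey_vertices"
  then obtain p q r s where zT: "z \<in> ftri p q r s" and d: "\<bar>p * s - q * r\<bar> = 1"
    unfolding farey_vertices_def using farey_triangles_ftri by blast
  have "\<exists>p q. z = rpt p q \<and> (p \<noteq> 0 \<or> q \<noteq> 0)"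
  proof -
    have "p \<noteq> 0 \<or> q \<noteq> 0" "r \<noteq> 0 \<or> s \<noteq> 0" using d by auto
    moreover have "p + r \<noteq> 0 \<or> q + s \<noteq> 0"
    proof (rule ccontr)
      assume "\<not> ?thesis"
      then have "r = - p" "s = - q" by auto
      then show False using d by simp
    qed
    ultimately show ?thesis using zT unfolding ftri_def by blast
  qed
  then obtain p q where z: "z = rpt p q" and nz: "p \<noteq> 0 \<or> q \<noteq> 0" by blast
  have "norm z = 1" using nz
    by (simp add: z rpt_def norm_divide complex_norm complex_eq_iff flip: of_int_power of_int_add)
  moreover have "Re z \<in> \<rat>" "Im z \<in> \<rat>"
    by (simp_all add: z rpt_def Re_divide Im_divide)
  ultimately show "z \<in> {z \<in> unit_circle. Re z \<in> \<rat> \<and> Im z \<in> \<rat>}" by simp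
next
  fix z assume "z \<in> {z \<in> unit_circle. Re z \<in> \<rat> \<and> Im z \<in> \<rat>}"
  then have z: "norm z = 1" "Re z \<in> \<rat>" "Im z \<in> \<rat>" by auto
  have "\<exists>p q. coprime p q \<and> z = rpt p q"
  proof (cases "z = -1")
    case True
    then have "z = rpt 0 1" by (simp add: rpt_def complex_eq_iff Re_divide Im_divide)
    then show ?thesis by (intro exI[of _ 0] exI[of _ 1]) simp
  next
    case False
    have sq: "(Re z)\<^sup>2 + (Im z)\<^sup>2 = 1" using z(1) by (metis cmod_power2 one_power2)
    have ne: "1 + Re z \<noteq> 0"
    proof
      assume "1 + Re z = 0"
      then have "Re z = -1" by simp
      then show False using sq False by (simp add: complex_eq_iff)
    qed
    have "Im z / (1 + Re z) \<in> \<rat>" using z by simp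
    then obtain q p where pq: "p > 0" "coprime q p" "Im z / (1 + Re z) = of_int q / of_int p"
      by (metis Rats_cases')
    have "(1 + Re z) * of_int q = Im z * of_int p" using pq ne by (simp add: field_simps)
    then have e1: "of_int q + Re z * of_int q = Im z * of_int p" by (simp add: algebra_simps)
    have "(1 + Re z) * (of_int p - Re z * of_int p - Im z * of_int q) =
       (1 - (Re z)\<^sup>2) * of_int p - Im z * (of_int q + Re z * of_int q)"
      by (simp add: algebra_simps power2_eq_square)
    also have "\<dots> = 0" unfolding e1 using sq by (simp add: power2_eq_square flip: sq)
    finally have e2: "of_int p = Re z * of_int p + Im z * of_int q" using ne by simp
    have "z * Complex (of_int p) (- of_int q) = Complex (of_int p) (of_int q)"
      using e1 e2 by (simp add: complex_eq_iff algebra_simps)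
    moreover have "Complex (of_int p) (- of_int q) \<noteq> 0" using pq(1) by (simp add: complex_eq_iff)
    ultimately have "z = rpt p q" unfolding rpt_def by (simp add: field_simps)
    then show ?thesis using pq(2) coprime_commute by blast
  qed
  then obtain p q where pq: "coprime p q" "z = rpt p q" by blast
  obtain x y where "x * p + y * q = 1" using bezout_int[of p q] pq(1) by auto
  then have "\<bar>p * x - q * (- y)\<bar> = 1" by (simp add: algebra_simps)
  then have "ftri p q (- y) x \<in> farey_triangles" by (rule ftri_farey)
  then show "z \<in> farey_vertices" using pq(2) by (auto simp: farey_vertices_def ftri_def)
qed

end

theory Submission
  imports Defs
begin

text \<open>Writing a point of the circle as \<open>w / cnj w\<close> for a nonzero plane vector \<open>w\<close> turns the elements
  of \<open>PSU(1,1)\<close> into real linear maps of determinant one, the vertices of the tessellation into primitive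
  integer vectors, and cross-ratios into quotients of determinants. A vanishing shear says that the
  linear map which matches \<open>h\<close> on one triangle also matches it on the adjacent one. Subdividing the two
  arcs between \<open>1\<close> and \<open>-1\<close> as in the Stern--Brocot tree until no edge with nonzero shear remains inside
  an arc, and using the density of the vertices, one sees that \<open>h\<close> is always piecewise Moebius with rational
  breakpoints.

  Along the fan of a vertex \<open>v\<close> the shears are the logarithms of the ratios of consecutive gaps between
  the images of the neighbours of \<open>v\<close>, in an affine coordinate that sends \<open>h v\<close> to infinity. Their sum
  telescopes, and since \<open>h\<close> is Moebius on both sides of \<open>v\<close> it equals the jump of \<open>ln h'\<close> at \<open>v\<close>. Hence the
  balanced condition says that \<open>ln h'\<close> is continuous, and then, being piecewise smooth, Lipschitz. A Lipschitz
  function lies in \<open>H\<^sup>1\<^sup>/\<^sup>2\<close>, whereas at a jump the defining double integral dominates a multiple of the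
  divergent integral of \<open>1 / r\<close> near \<open>r = 0\<close>.\<close>


section \<open>Homogeneous coordinates on the circle\<close>

text \<open>For nonzero \<open>w\<close> this is the square of \<open>w / norm w\<close>, so it
  doubles angles and is constant on nonzero real multiples: \<open>pt\<close> identifies the real
  projective line with the circle.\<close>

definition pt :: "complex \<Rightarrow> complex" where
  "pt w = w / cnj w"

text \<open>The determinant of the real matrix with columns \<open>w\<close> and
  \<open>v\<close>.\<close>

definition vdet :: "complex \<Rightarrow> complex \<Rightarrow> real" where
  "vdet w v = Im (cnj w * v)"

lemma vdet_simps [simp]:
  "vdet w w = 0" "vdet 0 w = 0" "vdet w 0 = 0" "vdet (- w) v = - vdet w v" "vdet w (- v) = - vdet w v"
  by (simp_all add: vdet_def)

lemma vdet_add: "vdet (u + v) w = vdet u w + vdet v w" "vdet w (u + v) = vdet w u + vdet w v"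
  by (simp_all add: vdet_def algebra_simps)

lemma vdet_diff: "vdet (u - v) w = vdet u w - vdet v w" "vdet w (u - v) = vdet w u - vdet w v"
  by (simp_all add: vdet_def algebra_simps)

lemma vdet_scale: "vdet (of_real r * u) w = r * vdet u w" "vdet w (of_real r * u) = r * vdet w u"
  by (simp_all add: vdet_def algebra_simps)

lemma vdet_commute: "vdet v w = - vdet w v"
  by (simp add: vdet_def algebra_simps)

lemma vdet_cis: "vdet (of_real r * cis a) (of_real s * cis b) = r * s * sin (b - a)"
  by (simp add: vdet_def sin_diff algebra_simps)

lemma pt_scale: "r \<noteq> 0 \<Longrightarrow> pt (of_real r * w) = pt w"
  by (simp add: pt_def)

lemma pt_uminus [simp]: "pt (- w) = pt w"
  by (simp add: pt_def)

lemma pt_cis: "pt (cis a) = cis (2 * a)"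
  by (simp add: pt_def cis_cnj cis_divide)

lemma pt_polar: "r \<noteq> 0 \<Longrightarrow> pt (of_real r * cis a) = cis (2 * a)"
  using pt_scale pt_cis by simp

lemma norm_pt: "w \<noteq> 0 \<Longrightarrow> norm (pt w) = 1"
  by (simp add: pt_def norm_divide)

lemma pt_surj:
  assumes "norm z = 1" obtains w where "norm w = 1" "pt w = z"
proof -
  have "z = cis (Arg z)" using assms by (metis cis_Arg_unique norm_one rcis_cmod_Arg rcis_def mult_1 of_real_1)
  then have "pt (cis (Arg z / 2)) = z" by (simp add: pt_cis)
  then show ?thesis using that[of "cis (Arg z / 2)"] by simp
qed

text \<open>Differences of circle points become determinants; the equality criterion, the chord
  length and the cross-ratio formula below are all read off from this identity.\<close>

lemma pt_diff:
  assumes "w \<noteq> 0" "v \<noteq> 0"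
  shows "pt w - pt v = - 2 * \<i> * of_real (vdet w v) / (cnj w * cnj v)"
proof -
  have "pt w - pt v = (w * cnj v - v * cnj w) / (cnj w * cnj v)"
    using assms by (simp add: pt_def field_simps)
  also have "w * cnj v - v * cnj w = - 2 * \<i> * of_real (vdet w v)"
    by (simp add: vdet_def complex_eq_iff algebra_simps)
  finally show ?thesis .
qed

lemma pt_eq_iff: "w \<noteq> 0 \<Longrightarrow> v \<noteq> 0 \<Longrightarrow> pt w = pt v \<longleftrightarrow> vdet w v = 0"
  using pt_diff[of w v] by auto

lemma vdet_zero_imp_scale:
  assumes "w \<noteq> 0" "vdet w v = 0" shows "\<exists>r. v = of_real r * w"
proof -
  have "Im (v / w) = 0" using assms(2) unfolding vdet_def Im_divide by (simp add: algebra_simps)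
  then have "v / w = of_real (Re (v / w))" by (simp add: complex_eq_iff)
  then have "v = of_real (Re (v / w)) * w" using assms(1) by (metis nonzero_divide_eq_eq)
  then show ?thesis by blast
qed

lemma norm_pt_diff:
  assumes "w \<noteq> 0" "v \<noteq> 0"
  shows "norm (pt w - pt v) = 2 * \<bar>vdet w v\<bar> / (norm w * norm v)"
  unfolding pt_diff[OF assms] by (simp add: norm_divide norm_mult)

text \<open>Each point contributes one conjugate factor to the numerator and one to the denominator,
  so these cancel and only determinants remain.\<close>

lemma cross_ratio_pt:
  assumes "a \<noteq> 0" "b \<noteq> 0" "c \<noteq> 0" "d \<noteq> 0"
  shows "cross_ratio (pt a) (pt b) (pt c) (pt d)
    = of_real ((vdet a b * vdet c d) / (vdet b c * vdet a d))"
proof -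
  obtain k where k: "k = - 2 * \<i>" "k \<noteq> 0" by simp
  let ?P = "cnj a * cnj b * cnj c * cnj d"
  note pd = pt_diff[folded k(1)]
  have n: "(pt b - pt a) * (pt d - pt c) = (k * k) * of_real (vdet a b * vdet c d) / ?P"
    and d: "(pt c - pt b) * (pt d - pt a) = (k * k) * of_real (vdet b c * vdet a d) / ?P"
    using assms by (simp_all add: pd vdet_commute[of b a] vdet_commute[of d c]
      vdet_commute[of c b] vdet_commute[of d a] mult_ac)
  have "k * k \<noteq> 0" "?P \<noteq> 0" using assms k by auto
  then show ?thesis unfolding cross_ratio_def n d of_real_divide by simp
qed

section \<open>Cyclic order and signs of determinants\<close>

lemma ccw3E:
  assumes "ccw [a, b, c]"
  obtains r s t where "a = cis r" "b = cis s" "c = cis t" "r < s" "s < t" "t < r + 2 * pi"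
  using assms unfolding ccw_def by (elim exE conjE) (auto simp: Cons_eq_map_conv)

lemma ccw4E:
  assumes "ccw [a, b, c, d]"
  obtains r s t u where "a = cis r" "b = cis s" "c = cis t" "d = cis u"
    "r < s" "s < t" "t < u" "u < r + 2 * pi"
  using assms unfolding ccw_def by (elim exE conjE) (auto simp: Cons_eq_map_conv)

lemma pt_eq_cis:
  assumes "w \<noteq> 0" "pt w = cis t" obtains r where "r \<noteq> 0" "w = of_real r * cis (t / 2)"
proof -
  have "pt (cis (t / 2)) = pt w" using assms by (simp add: pt_cis)
  then have "vdet (cis (t / 2)) w = 0" using assms(1) pt_eq_iff cis_neq_zero by blast
  then obtain r where "w = of_real r * cis (t / 2)" using vdet_zero_imp_scale cis_neq_zero by blast
  then show ?thesis using that[of r] assms(1) by auto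
qed

text \<open>Each vector is a nonzero real multiple of a half-angle vector and occurs twice in the
  product, so its sign is immaterial; what remains are sines of half differences in
  \<open>(0, pi)\<close>.\<close>

lemma ccw_pt_imp_pos:
  assumes "u \<noteq> 0" "v \<noteq> 0" "w \<noteq> 0" "ccw [pt u, pt v, pt w]"
  shows "vdet u v * vdet v w * vdet u w > 0"
proof -
  obtain r s t where p: "pt u = cis r" "pt v = cis s" "pt w = cis t"
    and o: "r < s" "s < t" "t < r + 2 * pi" using assms(4) by (rule ccw3E)
  obtain a where a: "a \<noteq> 0" "u = of_real a * cis (r / 2)" using pt_eq_cis[OF assms(1) p(1)] .
  obtain b where b: "b \<noteq> 0" "v = of_real b * cis (s / 2)" using pt_eq_cis[OF assms(2) p(2)] .
  obtain c where c: "c \<noteq> 0" "w = of_real c * cis (t / 2)" using pt_eq_cis[OF assms(3) p(3)] .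
  have s: "sin (s / 2 - r / 2) > 0" "sin (t / 2 - s / 2) > 0" "sin (t / 2 - r / 2) > 0"
    using o by (auto intro!: sin_gt_zero)
  have "vdet u v * vdet v w * vdet u w =
    (a * b * c)\<^sup>2 * (sin (s / 2 - r / 2) * sin (t / 2 - s / 2) * sin (t / 2 - r / 2))"
    by (simp add: a b c vdet_cis power2_eq_square)
  also have "\<dots> > 0" using s a(1) b(1) c(1) by simp
  finally show ?thesis .
qed

lemma cis_lift:
  assumes "norm z = 1" shows "\<exists>s. z = cis s \<and> r \<le> s \<and> s < r + 2 * pi"
proof -
  have 1: "z = cis (Arg z)" using assms by (metis rcis_cmod_Arg rcis_def mult_1 of_real_1)
  \<comment> \<open>The number of full turns that moves \<open>Arg z\<close> into the window of
    length \<open>2 * pi\<close> starting at \<open>r\<close>.\<close>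
  define k where "k = \<lceil>(r - Arg z) / (2 * pi)\<rceil>"
  have "(r - Arg z) / (2 * pi) \<le> k" "k < (r - Arg z) / (2 * pi) + 1"
    unfolding k_def by linarith+
  then have "r - Arg z \<le> k * (2 * pi)" "k * (2 * pi) < r - Arg z + 2 * pi"
    by (simp_all add: field_simps)
  moreover have "cis (Arg z + k * (2 * pi)) = z" using 1
    by (metis cis_mult cis_multiple_2pi Ints_of_int mult.commute mult_1_right mult.assoc)
  ultimately show ?thesis by (intro exI[of _ "Arg z + k * (2 * pi)"]) auto
qed

lemma ccw_cyclic_cases:
  assumes "norm a = 1" "norm b = 1" "norm c = 1" "a \<noteq> b" "b \<noteq> c" "a \<noteq> c"
  shows "ccw [a, b, c] \<or> ccw [a, c, b]"
proof -
  obtain r where r: "a = cis r" using cis_lift[OF assms(1)] by blast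
  obtain s where s: "b = cis s" "r \<le> s" "s < r + 2 * pi" using cis_lift[OF assms(2)] by blast
  obtain t where t: "c = cis t" "r \<le> t" "t < r + 2 * pi" using cis_lift[OF assms(3)] by blast
  have n: "r \<noteq> s" "r \<noteq> t" "s \<noteq> t" using assms r s t by auto
  have "ccw [a, b, c]" if "s < t" unfolding ccw_def
    by (rule exI[of _ "[r, s, t]"]) (use r s t n that in auto)
  moreover have "ccw [a, c, b]" if "t < s" unfolding ccw_def
    by (rule exI[of _ "[r, t, s]"]) (use r s t n that in auto)
  ultimately show ?thesis using n by linarith
qed

text \<open>For the converse, three distinct points are in one of the two cyclic orders, and the
  opposite order would make the product negative.\<close>

lemma ccw_pt_iff:
  assumes "u \<noteq> 0" "v \<noteq> 0" "w \<noteq> 0"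
  shows "ccw [pt u, pt v, pt w] \<longleftrightarrow> vdet u v * vdet v w * vdet u w > 0"
proof
  assume p: "vdet u v * vdet v w * vdet u w > 0"
  then have "pt u \<noteq> pt v" "pt v \<noteq> pt w" "pt u \<noteq> pt w" using pt_eq_iff assms by auto
  then have "ccw [pt u, pt v, pt w] \<or> ccw [pt u, pt w, pt v]"
    using assms by (intro ccw_cyclic_cases) (auto simp: norm_pt)
  moreover have "\<not> ccw [pt u, pt w, pt v]"
    using ccw_pt_imp_pos[OF assms(1,3,2)] p by (auto simp: vdet_commute[of w v] mult_ac)
  ultimately show "ccw [pt u, pt v, pt w]" by blast
qed (use ccw_pt_imp_pos assms in blast)

text \<open>When the two triples are joined, their angles for \<open>a\<close> and \<open>c\<close>
  may differ by full turns. Both gaps from \<open>a\<close> to \<open>c\<close> lie in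
  \<open>(0, 2 * pi)\<close>, so the numbers of turns agree and the angle of \<open>d\<close> is
  shifted by the same amount.\<close>

lemma ccw4_iff: "ccw [a, b, c, d] \<longleftrightarrow> ccw [a, b, c] \<and> ccw [a, c, d]"
proof
  assume "ccw [a, b, c, d]"
  then obtain p q r s where "a = cis p" "b = cis q" "c = cis r" "d = cis s"
    "p < q" "q < r" "r < s" "s < p + 2 * pi" by (rule ccw4E)
  then show "ccw [a, b, c] \<and> ccw [a, c, d]" unfolding ccw_def
    by (intro conjI exI[of _ "[p, q, r]"] exI[of _ "[p, r, s]"]) auto
next
  assume h: "ccw [a, b, c] \<and> ccw [a, c, d]"
  from h have "ccw [a, b, c]" by (rule conjunct1)
  then obtain p q r where ts: "a = cis p" "b = cis q" "c = cis r" "p < q" "q < r" "r < p + 2 * pi"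
    by (rule ccw3E)
  from h have "ccw [a, c, d]" by (rule conjunct2)
  then obtain p' r' s' where us: "a = cis p'" "c = cis r'" "d = cis s'" "p' < r'" "r' < s'" "s' < p' + 2 * pi"
    by (rule ccw3E)
  obtain k where k: "p = p' + of_int k * (2 * pi)"
    using sin_cos_eq_iff[of p p'] ts us by (auto simp: complex_eq_iff mult_ac)
  obtain l where l: "r = r' + of_int l * (2 * pi)"
    using sin_cos_eq_iff[of r r'] ts us by (auto simp: complex_eq_iff mult_ac)
  have "r - p = r' - p' + of_int (l - k) * (2 * pi)" using k l by (simp add: algebra_simps)
  moreover have "0 < r - p" "r - p < 2 * pi" "0 < r' - p'" "r' - p' < 2 * pi" using ts us by auto
  ultimately have "\<bar>of_int (l - k) * (2 * pi)\<bar> < 1 * (2 * pi)" by linarith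
  then have "\<bar>real_of_int (l - k)\<bar> < 1" by (simp add: abs_mult)
  then have lk: "l = k" by linarith
  define s where "s = s' + of_int k * (2 * pi)"
  have "cis s = cis s'" unfolding s_def
    by (metis cis_mult cis_multiple_2pi Ints_of_int mult.commute mult_1_right mult.assoc)
  then show "ccw [a, b, c, d]" unfolding ccw_def
    by (intro exI[of _ "[p, q, r, s]"]) (use ts us k l lk s_def in auto)
qed


section \<open>Farey quadrilaterals in integer coordinates\<close>

definition gauss_int :: "complex \<Rightarrow> bool" where
  "gauss_int w \<longleftrightarrow> Re w \<in> \<int> \<and> Im w \<in> \<int>"

lemma gauss_int_closed [simp]:
  "gauss_int u \<Longrightarrow> gauss_int v \<Longrightarrow> gauss_int (u + v)" "gauss_int u \<Longrightarrow> gauss_int v \<Longrightarrow> gauss_int (u - v)"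
  "gauss_int u \<Longrightarrow> gauss_int (- u)" "gauss_int u \<Longrightarrow> gauss_int (of_nat n * u)" "gauss_int u \<Longrightarrow> gauss_int (of_int k * u)"
  by (auto simp: gauss_int_def)

lemma gauss_int_vdet: "gauss_int u \<Longrightarrow> gauss_int v \<Longrightarrow> vdet u v \<in> \<int>"
  by (simp add: gauss_int_def vdet_def)

lemma rpt_pt: "rpt p q = pt (Complex (of_int p) (of_int q))"
  unfolding rpt_def pt_def by (rule arg_cong2[where f="(/)"]) (simp_all add: complex_eq_iff)

lemma gintE:
  assumes "gauss_int w" obtains p q where "w = Complex (of_int p) (of_int q)"
  using assms by (auto simp: gauss_int_def complex_eq_iff elim!: Ints_cases)

lemma vdet_one_nonzero: "\<bar>vdet w v\<bar> = 1 \<Longrightarrow> w \<noteq> 0 \<and> v \<noteq> 0"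
  by (auto simp: vdet_def)

lemma ftri_pt: "ftri p q r s =
    {pt (Complex p q), pt (Complex r s), pt (Complex p q + Complex r s)}"
  by (simp add: ftri_def rpt_pt complex_add)

lemma vdet_Complex: "vdet (Complex p q) (Complex r s) = p * s - q * r"
  by (simp add: vdet_def)

lemma farey_triangles_iff:
  "T \<in> farey_triangles \<longleftrightarrow> (\<exists>p q r. gauss_int p \<and> gauss_int q \<and> gauss_int r \<and> p + q + r = 0 \<and>
     \<bar>vdet p q\<bar> = 1 \<and> T = {pt p, pt q, pt r})" (is "_ \<longleftrightarrow> ?R")
proof
  assume "T \<in> farey_triangles"
  then obtain p q r s where T: "T = ftri p q r s" and d: "\<bar>p * s - q * r\<bar> = 1"
    using farey_triangles_ftri by blast
  let ?w = "Complex p q" and ?v = "Complex r s"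
  have "gauss_int ?w" "gauss_int ?v" by (simp_all add: gauss_int_def)
  moreover have "\<bar>vdet ?w ?v\<bar> = 1" unfolding vdet_Complex using d
    by (metis of_int_1 of_int_abs of_int_diff of_int_mult)
  moreover have "T = {pt ?w, pt ?v, pt (- (?w + ?v))}" unfolding T ftri_pt pt_uminus ..
  ultimately show ?R by (intro exI[of _ ?w] exI[of _ ?v] exI[of _ "- (?w + ?v)"]) simp
next
  assume ?R
  then obtain w v u where g: "gauss_int w" "gauss_int v" and u: "w + v + u = 0" and d: "\<bar>vdet w v\<bar> = 1"
    and T: "T = {pt w, pt v, pt u}" by blast
  obtain p q where w: "w = Complex (of_int p) (of_int q)" using gintE[OF g(1)] .
  obtain r s where v: "v = Complex (of_int r) (of_int s)" using gintE[OF g(2)] .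
  have "pt u = pt (w + v)" using minus_unique[OF u] pt_uminus by metis
  then have "T = ftri p q r s" unfolding T ftri_pt w v by simp
  moreover have "\<bar>real_of_int (p * s - q * r)\<bar> = 1" using d unfolding w v vdet_Complex by simp
  then have "\<bar>p * s - q * r\<bar> = 1" by linarith
  ultimately show "T \<in> farey_triangles" using ftri_farey by blast
qed

text \<open>The vector of the mediant vertex is negated, which makes the description of a triangle
  symmetric in its three vertices.\<close>

definition gtriple :: "complex \<Rightarrow> complex \<Rightarrow> complex \<Rightarrow> bool" where
  "gtriple p q r \<longleftrightarrow> gauss_int p \<and> gauss_int q \<and> gauss_int r \<and> p + q + r = 0 \<and> \<bar>vdet p q\<bar> = 1"

lemma gtriple_swap: "gtriple p q r \<Longrightarrow> gtriple q p r"
  by (simp add: gtriple_def vdet_commute[of q p] add.commute[of q p])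

lemma gtriple_rotate: 
  assumes "gtriple p q r" shows "gtriple q r p"
proof -
  have "r = - (p + q)" using assms by (metis minus_unique gtriple_def)
  then have "vdet q r = vdet p q" by (simp add: vdet_add vdet_diff vdet_commute[of q p])
  then show ?thesis using assms by (simp add: gtriple_def add_ac)
qed

text \<open>Rotations and swaps reach all six orders of a \<open>gtriple\<close>, so any two
  distinct vertices can be put first.\<close>

lemma farey_triangle_two:
  assumes "T \<in> farey_triangles" "a \<in> T" "b \<in> T" "a \<noteq> b"
  obtains p q r where "gtriple p q r" "a = pt p" "b = pt q" "T = {a, b, pt r}"
proof -
  obtain p q r where 1: "gtriple p q r" and T: "T = {pt p, pt q, pt r}"
    using assms(1) unfolding farey_triangles_iff gtriple_def by blast
  note 2 = gtriple_rotate[OF 1] note 3 = gtriple_rotate[OF 2]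
  consider "a = pt p" "b = pt q" | "a = pt p" "b = pt r" | "a = pt q" "b = pt r"
    | "a = pt q" "b = pt p" | "a = pt r" "b = pt p" | "a = pt r" "b = pt q"
    using assms T by blast
  then show ?thesis
    by cases (use that 1 2 3 gtriple_swap[OF 1] gtriple_swap[OF 2] gtriple_swap[OF 3] T in
      \<open>metis insert_commute\<close>)+
qed

lemma gtriple_nonzero:
  assumes "gtriple p q r" shows "p \<noteq> 0" "pt p \<noteq> pt q"
  using assms vdet_one_nonzero[of p q] by (auto simp: gtriple_def pt_eq_iff)

text \<open>If \<open>p = r * w\<close>, then up to sign \<open>r\<close> equals the integer
  \<open>vdet p v\<close> and its inverse equals the integer \<open>vdet w q\<close>; hence
  \<open>r\<close> is \<open>1\<close> or \<open>-1\<close>.\<close>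

lemma gauss_int_primitive_unique:
  assumes "gauss_int p" "gauss_int w" "\<bar>vdet p q\<bar> = 1" "gauss_int q" "\<bar>vdet w v\<bar> = 1" "gauss_int v" "pt p = pt w"
  shows "p = w \<or> p = - w"
proof -
  have nz: "p \<noteq> 0" "w \<noteq> 0" using assms(3,5) vdet_one_nonzero by blast+
  then have "vdet w p = 0" using assms(7) pt_eq_iff by metis
  then obtain r where r: "p = of_real r * w" using vdet_zero_imp_scale nz by blast
  have "vdet p v = r * vdet w v" "vdet p q = r * vdet w q" by (simp_all add: r vdet_scale)
  then have "\<bar>vdet p v\<bar> = \<bar>r\<bar>" and 1: "\<bar>r\<bar> * \<bar>vdet w q\<bar> = 1" using assms(3,5) by (auto simp: abs_mult)
  obtain k where k: "vdet p v = of_int k" using gauss_int_vdet[OF assms(1,6)] Ints_cases by blast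
  obtain l where l: "vdet w q = of_int l" using gauss_int_vdet[OF assms(2,4)] Ints_cases by blast
  have "\<bar>real_of_int k\<bar> * \<bar>real_of_int l\<bar> = 1" using 1 k l \<open>\<bar>vdet p v\<bar> = \<bar>r\<bar>\<close> by simp
  then have "\<bar>k\<bar> * \<bar>l\<bar> = 1" by (metis of_int_1 of_int_abs of_int_eq_iff of_int_mult)
  then have "\<bar>k\<bar> = 1" using zmult_eq_1_iff[of "\<bar>k\<bar>" "\<bar>l\<bar>"] by auto
  then have "\<bar>r\<bar> = 1" using \<open>\<bar>vdet p v\<bar> = \<bar>r\<bar>\<close> k by simp
  then show ?thesis using r by (cases "r \<ge> 0") auto
qed

text \<open>The vectors of the two given vertices are determined up to sign, and the four choices of
  signs yield only two third points. So an edge lies on at most two triangles.\<close>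

lemma farey_third_vertex:
  assumes "gauss_int w" "gauss_int v" "\<bar>vdet w v\<bar> = 1" "{pt w, pt v, z} \<in> farey_triangles"
  shows "z = pt (w + v) \<or> z = pt (v - w)"
proof -
  have "pt w \<noteq> pt v" using assms(3) vdet_one_nonzero[OF assms(3)] by (auto simp: pt_eq_iff)
  then obtain p q r where g: "gtriple p q r" and pq: "pt w = pt p" "pt v = pt q"
    and T: "{pt w, pt v, z} = {pt w, pt v, pt r}"
    using farey_triangle_two[OF assms(4)] by blast
  have "pt p \<noteq> pt r" "pt q \<noteq> pt r"
    using gtriple_nonzero(2)[OF gtriple_rotate[OF gtriple_rotate[OF g]]] gtriple_nonzero(2)[OF gtriple_rotate[OF g]] by auto
  moreover have "pt r \<in> {pt p, pt q, z}" unfolding T[unfolded pq] by simp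
  ultimately have z: "z = pt r" by auto
  have r: "r = - (p + q)" using g by (metis minus_unique gtriple_def)
  have "p = w \<or> p = - w"
    using gauss_int_primitive_unique[of p w q v] g assms pq by (simp add: gtriple_def)
  moreover have "q = v \<or> q = - v"
    using gauss_int_primitive_unique[of q v p w] g assms pq
    by (simp add: gtriple_def vdet_commute[of q p] vdet_commute[of v w])
  ultimately have "r = - (w + v) \<or> r = v - w \<or> r = - (v - w) \<or> r = w + v" unfolding r by auto
  then show ?thesis unfolding z using pt_uminus by metis
qed

lemma farey_triangleI:
  assumes "gauss_int w" "gauss_int v" "\<bar>vdet w v\<bar> = 1"
  shows "{pt w, pt v, pt (w + v)} \<in> farey_triangles" "{pt w, pt v, pt (v - w)} \<in> farey_triangles"
proof -
  have "{pt w, pt v, pt (- (w + v))} \<in> farey_triangles"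
    unfolding farey_triangles_iff using assms
    by (intro exI[of _ w] exI[of _ v] exI[of _ "- (w + v)"]) simp
  then show "{pt w, pt v, pt (w + v)} \<in> farey_triangles" unfolding pt_uminus .
  have "{pt (- w), pt v, pt (w - v)} \<in> farey_triangles"
    unfolding farey_triangles_iff using assms
    by (intro exI[of _ "- w"] exI[of _ v] exI[of _ "w - v"]) simp
  then show "{pt w, pt v, pt (v - w)} \<in> farey_triangles"
    by (metis minus_diff_eq pt_uminus)
qed

lemma farey_edgeI:
  assumes "gauss_int w" "gauss_int v" "\<bar>vdet w v\<bar> = 1"
  shows "{pt w, pt v} \<in> farey_edges"
proof -
  have "pt w \<noteq> pt v" using assms(3) vdet_one_nonzero[OF assms(3)] by (auto simp: pt_eq_iff)
  then show ?thesis unfolding farey_edges_def using farey_triangleI[OF assms] by blast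
qed

lemma farey_edgeE:
  assumes "{a, b} \<in> farey_edges"
  obtains w v where "gauss_int w" "gauss_int v" "vdet w v = 1" "a = pt w" "b = pt v"
proof -
  obtain T where T: "T \<in> farey_triangles" "a \<in> T" "b \<in> T" and ne: "a \<noteq> b"
    using assms unfolding farey_edges_def by (auto simp: doubleton_eq_iff)
  then obtain x y z where xy: "gtriple x y z" "a = pt x" "b = pt y"
    using farey_triangle_two by metis
  show ?thesis
  proof (cases "vdet x y = 1")
    case True
    then show ?thesis using that[of x y] xy by (simp add: gtriple_def)
  next
    case False
    then have "vdet (- x) y = 1" using xy(1) unfolding gtriple_def vdet_simps by linarith
    then show ?thesis using that[of "- x" y] xy by (simp add: gtriple_def)
  qed
qed

lemma farey_vertexE:
  assumes "z \<in> farey_vertices"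
  obtains w v where "gauss_int w" "gauss_int v" "vdet w v = 1" "z = pt w"
proof -
  obtain T where T: "T \<in> farey_triangles" "z \<in> T" using assms unfolding farey_vertices_def by blast
  then obtain p q r where "gtriple p q r" "T = {pt p, pt q, pt r}"
    using farey_triangles_iff gtriple_def by metis
  then obtain y where y: "y \<in> T" "y \<noteq> z" using gtriple_nonzero(2) by (metis insertI1 insertI2)
  then have "{z, y} \<in> farey_edges" using T unfolding farey_edges_def by blast
  then show ?thesis using that farey_edgeE by metis
qed

lemma farey_vertexI: "gauss_int w \<Longrightarrow> gauss_int v \<Longrightarrow> \<bar>vdet w v\<bar> = 1 \<Longrightarrow> pt w \<in> farey_vertices"
  unfolding farey_vertices_def using farey_triangleI by blast

lemma farey_quad_exists:
  assumes "gauss_int w" "gauss_int v" "vdet w v = 1"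
  shows "farey_quad {pt w, pt v} (pt w) (pt (w + v)) (pt v) (pt (v - w))"
proof -
  have nz: "w \<noteq> 0" "v \<noteq> 0" using vdet_one_nonzero[of w v] assms(3) by auto
  have nz': "w + v \<noteq> 0" "v - w \<noteq> 0" using assms(3) by (auto simp: add_eq_0_iff)
  have "ccw [pt w, pt (w + v), pt v]" "ccw [pt w, pt v, pt (v - w)]"
    using nz nz' assms(3) by (simp_all add: ccw_pt_iff vdet_add vdet_diff vdet_commute[of v w])
  moreover have "{pt w, pt (w + v), pt v} \<in> farey_triangles" "{pt w, pt v, pt (v - w)} \<in> farey_triangles"
    using farey_triangleI[of w v] assms by (simp_all add: insert_commute)
  ultimately show ?thesis unfolding farey_quad_def ccw4_iff by simp
qed

text \<open>Only two third vertices are possible, and the orientation decides which of them is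
  \<open>b\<close> and which is \<open>d\<close>.\<close>

lemma farey_quad_unique:
  assumes "gauss_int w" "gauss_int v" "vdet w v = 1" "farey_quad e (pt w) b (pt v) d"
  shows "b = pt (w + v) \<and> d = pt (v - w)"
proof -
  have q: "ccw [pt w, b, pt v]" "ccw [pt w, pt v, d]"
    "{pt w, b, pt v} \<in> farey_triangles" "{pt w, pt v, d} \<in> farey_triangles"
    using assms(4) unfolding farey_quad_def ccw4_iff by auto
  have nz: "w \<noteq> 0" "v \<noteq> 0" using vdet_one_nonzero[of w v] assms(3) by auto
  have nz': "w + v \<noteq> 0" "v - w \<noteq> 0" using assms(3) by (auto simp: add_eq_0_iff)
  have "b = pt (w + v) \<or> b = pt (v - w)"
    using farey_third_vertex[of w v b] assms q(3) by (simp add: insert_commute)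
  moreover have "d = pt (w + v) \<or> d = pt (v - w)"
    using farey_third_vertex[of w v d] assms q(4) by simp
  moreover have "\<not> ccw [pt w, pt (v - w), pt v]" "\<not> ccw [pt w, pt v, pt (w + v)]"
    using nz nz' assms(3) by (simp_all add: ccw_pt_iff vdet_add vdet_diff vdet_commute[of v w])
  ultimately show ?thesis using q by auto
qed

lemma shear_eq:
  assumes "gauss_int w" "gauss_int v" "vdet w v = 1"
  shows "shear h {pt w, pt v} =
    ln (Re (cross_ratio (h (pt w)) (h (pt (w + v))) (h (pt v)) (h (pt (v - w)))))"
  unfolding shear_def
proof (rule the_equality)
  show "\<exists>a b c d. farey_quad {pt w, pt v} a b c d \<and>
    ln (Re (cross_ratio (h (pt w)) (h (pt (w + v))) (h (pt v)) (h (pt (v - w))))) =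
    ln (Re (cross_ratio (h a) (h b) (h c) (h d)))"
    using farey_quad_exists[OF assms] by blast
  fix s assume "\<exists>a b c d. farey_quad {pt w, pt v} a b c d \<and>
    s = ln (Re (cross_ratio (h a) (h b) (h c) (h d)))"
  then obtain a b c d where q: "farey_quad {pt w, pt v} a b c d"
    and s: "s = ln (Re (cross_ratio (h a) (h b) (h c) (h d)))" by blast
  have "{pt w, pt v} = {a, c}" using q by (simp add: farey_quad_def)
  then consider "a = pt w" "c = pt v" | "a = pt v" "c = pt w" by (auto simp: doubleton_eq_iff)
  then show "s = ln (Re (cross_ratio (h (pt w)) (h (pt (w + v))) (h (pt v)) (h (pt (v - w)))))"
  proof cases
    case 1
    then show ?thesis using farey_quad_unique[OF assms] q s by simp
  next
    case 2
    \<comment> \<open>Reading the edge from its other end replaces the basis \<open>w, v\<close> by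
      \<open>v, - w\<close>. This exchanges the two opposite vertices and leaves the cross-ratio
      unchanged.\<close>
    have "vdet v (- w) = 1" using assms(3) by (simp add: vdet_commute[of v w])
    then have "b = pt (v - w) \<and> d = pt (- w - v)"
      using farey_quad_unique[of v "- w" _ b d] q 2 assms by simp
    moreover have "pt (- w - v) = pt (w + v)" using pt_uminus[of "w + v"] by simp
    moreover have "cross_ratio x y z t = cross_ratio z t x y" for x y z t
    proof -
      have "(y - x) * (t - z) = (t - z) * (y - x)" "(z - y) * (t - x) = (x - t) * (y - z)"
        by (simp_all add: algebra_simps)
      then show ?thesis unfolding cross_ratio_def by simp
    qed
    ultimately show ?thesis using 2 s by metis
  qed
qed


section \<open>Vanishing shears and Moebius arcs\<close>

definition moebius :: "complex \<Rightarrow> complex \<Rightarrow> complex \<Rightarrow> complex" where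
  "moebius \<alpha> \<beta> z = (\<alpha> * z + \<beta>) / (cnj \<beta> * z + cnj \<alpha>)"

text \<open>The complex form of a real linear map of the plane. Its determinant is
  \<open>(norm \<alpha>)^2 - (norm \<beta>)^2\<close>, and through \<open>pt\<close> it induces
  \<open>moebius\<close> on the circle.\<close>

definition rlinear :: "complex \<Rightarrow> complex \<Rightarrow> complex \<Rightarrow> complex" where
  "rlinear \<alpha> \<beta> w = \<alpha> * w + \<beta> * cnj w"

lemma moebius_PSU11: "(norm \<alpha>)\<^sup>2 - (norm \<beta>)\<^sup>2 = 1 \<Longrightarrow> moebius \<alpha> \<beta> \<in> PSU11"
  unfolding PSU11_def moebius_def by blast

lemma PSU11_moebius:
  assumes "g \<in> PSU11" obtains \<alpha> \<beta> where "(norm \<alpha>)\<^sup>2 - (norm \<beta>)\<^sup>2 = 1" "g = moebius \<alpha> \<beta>"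
  using assms unfolding PSU11_def moebius_def by blast

lemma pt_rlinear:
  assumes "w \<noteq> 0" shows "pt (rlinear \<alpha> \<beta> w) = moebius \<alpha> \<beta> (pt w)"
proof -
  have "pt (rlinear \<alpha> \<beta> w) = (\<alpha> * w + \<beta> * cnj w) / (cnj \<alpha> * cnj w + cnj \<beta> * w)"
    by (simp add: pt_def rlinear_def)
  also have "\<dots> = ((\<alpha> * w + \<beta> * cnj w) / cnj w) / ((cnj \<alpha> * cnj w + cnj \<beta> * w) / cnj w)"
    using assms by simp
  also have "\<dots> = moebius \<alpha> \<beta> (pt w)"
    using assms by (simp add: moebius_def pt_def add_divide_distrib add.commute)
  finally show ?thesis .
qed

lemma rlinear_lincomb:
  "rlinear \<alpha> \<beta> (of_real a * x + of_real b * y) = of_real a * rlinear \<alpha> \<beta> x + of_real b * rlinear \<alpha> \<beta> y"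
  by (simp add: rlinear_def algebra_simps)

lemma vdet_rlinear: "vdet (rlinear \<alpha> \<beta> x) (rlinear \<alpha> \<beta> y) = ((norm \<alpha>)\<^sup>2 - (norm \<beta>)\<^sup>2) * vdet x y"
  unfolding cmod_power2 by (simp add: rlinear_def vdet_def algebra_simps power2_eq_square)

text \<open>Cramer's rule; before division by \<open>vdet w v\<close> it is an identity for any
  three plane vectors.\<close>

lemma vdet_expand:
  assumes "vdet w v = 1" shows "z = of_real (vdet z v) * w + of_real (vdet w z) * v"
proof -
  have "of_real (vdet w v) * z = of_real (vdet z v) * w + of_real (vdet w z) * v"
    by (simp add: vdet_def complex_eq_iff algebra_simps)
  then show ?thesis using assms by simp
qed

lemma rlinear_exists:
  assumes "vdet w v = 1" "vdet A B = 1"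
  obtains \<alpha> \<beta> where "(norm \<alpha>)\<^sup>2 - (norm \<beta>)\<^sup>2 = 1" "rlinear \<alpha> \<beta> w = A" "rlinear \<alpha> \<beta> v = B"
proof -
  \<comment> \<open>The solution by Cramer's rule of the two equations
    \<open>rlinear \<alpha> \<beta> w = A\<close> and \<open>rlinear \<alpha> \<beta> v = B\<close>,
    whose determinant \<open>w * cnj v - v * cnj w\<close> is \<open>- 2 * \<i>\<close>.\<close>
  define \<alpha> \<beta> where "\<alpha> = (A * cnj v - B * cnj w) * \<i> / 2" and "\<beta> = (w * B - v * A) * \<i> / 2"
  have "rlinear \<alpha> \<beta> w = of_real (vdet w v) * A" "rlinear \<alpha> \<beta> v = of_real (vdet w v) * B"
    by (simp_all add: \<alpha>_def \<beta>_def rlinear_def vdet_def complex_eq_iff field_simps)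
  then have r: "rlinear \<alpha> \<beta> w = A" "rlinear \<alpha> \<beta> v = B" using assms(1) by simp_all
  then have "(norm \<alpha>)\<^sup>2 - (norm \<beta>)\<^sup>2 = 1" using vdet_rlinear[of \<alpha> \<beta> w v] assms by simp
  then show ?thesis using that r by blast
qed

text \<open>Multiplying the positive products of the triples \<open>a, b, c\<close> and
  \<open>a, c, d\<close> leaves the claim times the square of \<open>vdet a c\<close>.\<close>

lemma vdet_cross_pos:
  assumes "a \<noteq> 0" "b \<noteq> 0" "c \<noteq> 0" "d \<noteq> 0" "ccw [pt a, pt b, pt c, pt d]"
  shows "(vdet a b * vdet c d) / (vdet b c * vdet a d) > 0"
proof -
  have "vdet a b * vdet b c * vdet a c > 0" "vdet a c * vdet c d * vdet a d > 0"
    using assms by (simp_all add: ccw4_iff ccw_pt_iff)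
  then have "(vdet a b * vdet b c * vdet a c) * (vdet a c * vdet c d * vdet a d) > 0" by simp
  then have "(vdet a c)\<^sup>2 * ((vdet a b * vdet c d) * (vdet b c * vdet a d)) > 0"
    by (simp add: power2_eq_square mult_ac)
  then have "(vdet a b * vdet c d) * (vdet b c * vdet a d) > 0"
    by (metis zero_less_mult_pos zero_less_power2 mult_zero_left zero_power2 less_irrefl)
  then show ?thesis by (simp add: zero_less_divide_iff zero_less_mult_iff)
qed

text \<open>The half-angle vector of a point on the arc lies in the cone spanned by \<open>w\<close>
  and \<open>v\<close>: its coefficients are nonnegative multiples of sines. Dividing by their sum
  turns it into a point of the segment.\<close>

lemma cone_angle:
  assumes w: "w = of_real r * cis (a / 2)" "r > 0" and v: "v = of_real s * cis (b / 2)" "s > 0"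
    and d: "vdet w v = 1" and x: "a \<le> x" "x \<le> b" "a < b" "b < a + 2 * pi"
  obtains t k where "0 \<le> t" "t \<le> 1" "k > 0"
    "cis (x / 2) = of_real k * (of_real (1 - t) * w + of_real t * v)"
proof -
  define p q where "p = vdet (cis (x / 2)) v" and "q = vdet w (cis (x / 2))"
  have p: "p = s * sin (b / 2 - x / 2)" using vdet_cis[of 1 "x / 2" s "b / 2"] by (simp add: p_def v)
  have q: "q = r * sin (x / 2 - a / 2)" using vdet_cis[of r "a / 2" 1 "x / 2"] by (simp add: q_def w)
  have "p \<ge> 0" "q \<ge> 0" unfolding p q using w v x by (auto intro!: mult_nonneg_nonneg sin_ge_zero)
  moreover have e: "cis (x / 2) = of_real p * w + of_real q * v"
    unfolding p_def q_def by (rule vdet_expand[OF d])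
  moreover have "p \<noteq> 0 \<or> q \<noteq> 0" using e by (metis add_0 mult_zero_left of_real_0 cis_neq_zero)
  ultimately have pq: "p + q > 0" by linarith
  have "cis (x / 2) = of_real (p + q) * (of_real (1 - q / (p + q)) * w + of_real (q / (p + q)) * v)"
  proof -
    have "of_real (p + q) * (of_real (1 - q / (p + q)) * w + of_real (q / (p + q)) * v)
      = of_real ((p + q) * (1 - q / (p + q))) * w + of_real ((p + q) * (q / (p + q))) * v"
      by (simp only: of_real_mult distrib_left mult.assoc)
    moreover have "(p + q) * (1 - q / (p + q)) = p" "(p + q) * (q / (p + q)) = q"
      using pq by (simp_all add: field_simps)
    ultimately show ?thesis using e by (simp only:)
  qed
  then show ?thesis using that[of "q / (p + q)" "p + q"] pq \<open>p \<ge> 0\<close> \<open>q \<ge> 0\<close> by simp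
qed

section \<open>Continuing a linear model of \<open>h\<close> across Farey triangles\<close>

locale oriented_circle_homeo =
  fixes h :: "complex \<Rightarrow> complex"
  assumes homeo: "circle_homeo h" and orient: "orientation_preserving h"
begin

lemma continuous_h: "continuous_on unit_circle h"
  using homeo by (auto simp: circle_homeo_def homeomorphism_def)

lemma norm_h: "norm z = 1 \<Longrightarrow> norm (h z) = 1"
proof -
  assume "norm z = 1"
  moreover have "h ` unit_circle = unit_circle" using homeo by (auto simp: circle_homeo_def homeomorphism_def)
  ultimately have "h z \<in> unit_circle" by auto
  then show ?thesis by simp
qed

lemma ccw3_h: "ccw [a, b, c] \<Longrightarrow> ccw [h a, h b, h c]"
  using orient by (simp add: orientation_preserving_def)

lemma ccw4_h: "ccw [a, b, c, d] \<Longrightarrow> ccw [h a, h b, h c, h d]"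
  using ccw3_h by (simp add: ccw4_iff)

lemma h_lift:
  assumes "w \<noteq> 0" obtains u where "norm u = 1" "u \<noteq> 0" "h (pt w) = pt u"
  using pt_surj[OF norm_h[OF norm_pt[OF assms]]] by (metis norm_zero zero_neq_one)

text \<open>The linear map taking \<open>w, v\<close> to \<open>A, B\<close> then induces a Moebius
  map that agrees with \<open>h\<close> at the three vertices of a Farey triangle.\<close>

definition frame :: "complex \<Rightarrow> complex \<Rightarrow> complex \<Rightarrow> complex \<Rightarrow> bool" where
  "frame w v A B \<longleftrightarrow> gauss_int w \<and> gauss_int v \<and> vdet w v = 1 \<and> vdet A B = 1 \<and>
     h (pt w) = pt A \<and> h (pt v) = pt B \<and> h (pt (w + v)) = pt (A + B)"

text \<open>Scaling representatives \<open>a, b\<close> of the end images by \<open>x, y\<close>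
  makes their sum parallel to the image \<open>c\<close> of the mediant. The factor \<open>k\<close>
  then normalises the determinant; its square root exists because \<open>h\<close> preserves
  orientation.\<close>

lemma frame_exists:
  assumes "gauss_int w" "gauss_int v" "vdet w v = 1"
  shows "\<exists>A B. frame w v A B"
proof -
  have nz: "w \<noteq> 0" "v \<noteq> 0" "w + v \<noteq> 0" using assms(3) by (auto simp: add_eq_0_iff)
  obtain a where a: "a \<noteq> 0" "h (pt w) = pt a" using h_lift[OF nz(1)] .
  obtain b where b: "b \<noteq> 0" "h (pt v) = pt b" using h_lift[OF nz(2)] .
  obtain c where c: "c \<noteq> 0" "h (pt (w + v)) = pt c" using h_lift[OF nz(3)] .
  have "ccw [pt w, pt (w + v), pt v]" using nz assms(3) by (simp add: ccw_pt_iff vdet_add)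
  then have "ccw [pt a, pt c, pt b]" using ccw3_h a b c by metis
  then have pos: "vdet a c * vdet c b * vdet a b > 0" using a b c by (simp add: ccw_pt_iff)
  define x y where "x = vdet c b" and "y = vdet a c"
  have 1: "of_real (vdet a b) * c = of_real x * a + of_real y * b"
    unfolding x_def y_def by (simp add: vdet_def complex_eq_iff algebra_simps)
  have xyp: "x * y * vdet a b > 0" using pos by (simp add: x_def y_def mult_ac)
  define k where "k = 1 / sqrt (x * y * vdet a b)"
  have k: "k \<noteq> 0" "k * k * (x * y * vdet a b) = 1" using xyp by (auto simp: k_def)
  have nz': "x \<noteq> 0" "y \<noteq> 0" "vdet a b \<noteq> 0" using xyp by auto
  define A B where "A = of_real (k * x) * a" and "B = of_real (k * y) * b"
  have "pt A = pt a" "pt B = pt b" unfolding A_def B_def using k nz' by (intro pt_scale; simp)+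
  moreover have "A + B = of_real (k * vdet a b) * c"
    using 1 unfolding A_def B_def of_real_mult by (metis (no_types, lifting) distrib_left mult.assoc)
  then have "pt (A + B) = pt c" using k nz' by (metis pt_scale mult_eq_0_iff)
  moreover have "vdet A B = 1" unfolding A_def B_def vdet_scale using k(2) by (simp add: mult_ac)
  ultimately show ?thesis unfolding frame_def using assms a b c by metis
qed

text \<open>\<open>K\<close> is the cross-ratio of the images, where \<open>X\<close> represents the
  image of the new mediant. A vanishing shear means \<open>K = 1\<close>, which forces
  \<open>X\<close> to be parallel to \<open>A + (A + B)\<close>, so the same linear map serves the
  adjacent triangle.\<close>

lemma frame_left:
  assumes f: "frame w v A B" and z: "shear h {pt w, pt (w + v)} = 0"
  shows "frame w (w + v) A (A + B)"
proof -
  have g: "gauss_int w" "gauss_int v" "vdet w v = 1" "vdet A B = 1" and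
    im: "h (pt w) = pt A" "h (pt v) = pt B" "h (pt (w + v)) = pt (A + B)"
    using f by (auto simp: frame_def)
  have g': "gauss_int (w + v)" "vdet w (w + v) = 1" using g by (simp_all add: vdet_add)
  have "vdet (w + (w + v)) v = 2" "vdet (A + (A + B)) B = 2" "vdet (A + B) B = 1" unfolding vdet_add using g by simp_all
  then have nz: "w + (w + v) \<noteq> 0" "A + (A + B) \<noteq> 0" "A + B \<noteq> 0" "A \<noteq> 0" "B \<noteq> 0"
    using g by auto
  obtain X where X: "X \<noteq> 0" "h (pt (w + (w + v))) = pt X" using h_lift[OF nz(1)] .
  have vv: "w + v - w = v" by simp
  note q = farey_quad_exists[OF g(1) g', unfolded vv]
  have "ccw [h (pt w), h (pt (w + (w + v))), h (pt (w + v)), h (pt v)]"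
    using q ccw4_h by (simp add: farey_quad_def)
  then have c: "ccw [pt A, pt X, pt (A + B), pt B]" unfolding im X .
  define K where "K = vdet A X * vdet (A + B) B / (vdet X (A + B) * vdet A B)"
  have K: "K > 0" unfolding K_def using vdet_cross_pos[OF _ _ _ _ c] nz X by simp
  have "ln K = 0" using shear_eq[OF g(1) g', unfolded vv, of h] z
    unfolding im X cross_ratio_pt[OF nz(4) X(1) nz(3,5)] by (simp add: K_def)
  then have "K = 1" using K by simp
  then have "vdet A X = vdet X (A + B)" using g \<open>vdet (A + B) B = 1\<close> by (simp add: K_def)
  then have "vdet X (A + (A + B)) = 0" unfolding vdet_add vdet_commute[of X A] by simp
  then have "pt X = pt (A + (A + B))" using pt_eq_iff X(1) nz(2) by blast
  then show ?thesis using g g' im X by (simp add: frame_def vdet_add)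
qed

text \<open>The counterpart of \<open>frame_left\<close> across the other new edge.\<close>

lemma frame_right:
  assumes f: "frame w v A B" and z: "shear h {pt (w + v), pt v} = 0"
  shows "frame (w + v) v (A + B) B"
proof -
  have g: "gauss_int w" "gauss_int v" "vdet w v = 1" "vdet A B = 1" and
    im: "h (pt w) = pt A" "h (pt v) = pt B" "h (pt (w + v)) = pt (A + B)"
    using f by (auto simp: frame_def)
  have g': "gauss_int (w + v)" "vdet (w + v) v = 1" using g by (simp_all add: vdet_add)
  have "vdet w (w + v + v) = 2" "vdet A (A + B + B) = 2" "vdet (A + B) B = 1" unfolding vdet_add using g by simp_all
  then have nz: "w + v + v \<noteq> 0" "A + B + B \<noteq> 0" "A + B \<noteq> 0" "A \<noteq> 0" "B \<noteq> 0"
    using g by auto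
  obtain X where X: "X \<noteq> 0" "h (pt (w + v + v)) = pt X" using h_lift[OF nz(1)] .
  have vv: "v - (w + v) = - w" by simp
  note q = farey_quad_exists[OF g'(1) g(2) g'(2), unfolded vv pt_uminus]
  have "ccw [h (pt (w + v)), h (pt (w + v + v)), h (pt v), h (pt w)]"
    using q ccw4_h by (simp add: farey_quad_def)
  then have c: "ccw [pt (A + B), pt X, pt B, pt A]" unfolding im X .
  define K where "K = vdet (A + B) X * vdet B A / (vdet X B * vdet (A + B) A)"
  have K: "K > 0" unfolding K_def using vdet_cross_pos[OF _ _ _ _ c] nz X by simp
  have "ln K = 0" using shear_eq[OF g'(1) g(2) g'(2), unfolded vv pt_uminus, of h] z
    unfolding im X cross_ratio_pt[OF nz(3) X(1) nz(5,4)] by (simp add: K_def)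
  then have "K = 1" using K by simp
  moreover have "vdet B A = - 1" using g by (simp add: vdet_commute[of B A])
  moreover have "vdet (A + B) A = - 1" using g \<open>vdet B A = - 1\<close> by (simp add: vdet_add)
  ultimately have "vdet (A + B) X = vdet X B" by (simp add: K_def)
  then have "vdet X (A + B + B) = 0" unfolding vdet_add vdet_commute[of X A] vdet_commute[of X B] by simp
  then have "pt X = pt (A + B + B)" using pt_eq_iff X(1) nz(2) by blast
  then show ?thesis using g g' im X by (simp add: frame_def vdet_add)
qed

text \<open>The condition \<open>b + c > 0\<close> exempts the edge from \<open>pt w\<close> to \<open>pt v\<close> itself, whose shear also depends on
  the triangle on its other side.\<close>

definition zero_inside :: "complex \<Rightarrow> complex \<Rightarrow> bool" where
  "zero_inside w v \<longleftrightarrow> (\<forall>a b c d. a * d = b * c + 1 \<and> b + c > 0 \<longrightarrow>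
     shear h {pt (of_nat a * w + of_nat b * v), pt (of_nat c * w + of_nat d * v)} = 0)"

text \<open>Vanishing passes to both halves of the arc: rewriting combinations of the new basis in
  terms of \<open>w\<close> and \<open>v\<close> multiplies the coefficient matrix by an elementary
  matrix of determinant one.\<close>

lemma zero_insideD:
  assumes "zero_inside w v"
  shows "shear h {pt w, pt (w + v)} = 0" "shear h {pt (w + v), pt v} = 0"
    "zero_inside w (w + v)" "zero_inside (w + v) v"
proof -
  note z = assms[unfolded zero_inside_def, rule_format]
  show "shear h {pt w, pt (w + v)} = 0" using z[of 1 1 0 1] by simp
  show "shear h {pt (w + v), pt v} = 0" using z[of 1 1 1 0] by simp
  show "zero_inside w (w + v)" unfolding zero_inside_def
  proof (intro allI impI)
    fix a b c d :: nat assume "a * d = b * c + 1 \<and> b + c > 0"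
    then have "(a + b) * d = b * (c + d) + 1 \<and> b + (c + d) > 0" by (auto simp: algebra_simps)
    from z[OF this] show "shear h {pt (of_nat a * w + of_nat b * (w + v)), pt (of_nat c * w + of_nat d * (w + v))} = 0"
      by (simp add: algebra_simps)
  qed
  show "zero_inside (w + v) v" unfolding zero_inside_def
  proof (intro allI impI)
    fix a b c d :: nat assume "a * d = b * c + 1 \<and> b + c > 0"
    then have "a * (c + d) = (a + b) * c + 1 \<and> (a + b) + c > 0" by (auto simp: algebra_simps)
    from z[OF this] show "shear h {pt (of_nat a * (w + v) + of_nat b * v), pt (of_nat c * (w + v) + of_nat d * v)} = 0"
      by (simp add: algebra_simps)
  qed
qed

text \<open>The subtractive Euclidean algorithm on \<open>a, b\<close>: each subtraction passes to
  the half of the arc that contains the point, and the linear map stays the same.\<close>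

lemma zero_inside_nat_combination:
  assumes "frame w v A B" "zero_inside w v" "coprime a b"
  shows "h (pt (of_nat a * w + of_nat b * v)) = pt (of_nat a * A + of_nat b * B)"
  using assms
proof (induction "a + b" arbitrary: a b w v A B rule: less_induct)
  case less
  note z = zero_insideD[OF less.prems(2)]
  consider "a = 0" | "b = 0" | "a = b" | "a > b" "b > 0" | "b > a" "a > 0" by linarith
  then show ?case
  proof cases
    case 1
    then show ?thesis using less.prems by (simp add: frame_def)
  next
    case 2
    then show ?thesis using less.prems by (simp add: frame_def)
  next
    \<comment> \<open>Coprimality forces \<open>a = b = 1\<close>, the mediant, whose image is
      recorded in \<open>frame\<close>.\<close>
    case 3
    then show ?thesis using less.prems by (simp add: frame_def)
  next
    case 4
    have "a - b + b < a + b" "coprime (a - b) b" using 4 less.prems(3)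
      by (auto simp: coprime_iff_gcd_eq_1 gcd_diff1_nat)
    from less.hyps[OF this(1) frame_left[OF less.prems(1) z(1)] z(3) this(2)]
    show ?thesis using 4 by (simp add: of_nat_diff algebra_simps)
  next
    case 5
    have "a + (b - a) < a + b" "coprime a (b - a)" using 5 less.prems(3)
      by (auto simp: coprime_iff_gcd_eq_1 gcd.commute[of a] gcd_diff1_nat)
    from less.hyps[OF this(1) frame_right[OF less.prems(1) z(2)] z(4) this(2)]
    show ?thesis using 5 by (simp add: of_nat_diff algebra_simps)
  qed
qed

lemma segment_nonzero:
  assumes "vdet w v = 1" shows "of_real (1 - t) * w + of_real t * v \<noteq> 0"
proof
  assume "of_real (1 - t) * w + of_real t * v = 0"
  then have "vdet (of_real (1 - t) * w + of_real t * v) v = 0" "vdet w (of_real (1 - t) * w + of_real t * v) = 0"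
    by simp_all
  then show False using assms by (simp add: vdet_add vdet_scale del: of_real_diff)
qed

text \<open>A rational parameter \<open>p / q\<close> gives, up to the factor \<open>q\<close>, a
  coprime combination of \<open>w\<close> and \<open>v\<close>. Continuity of \<open>h\<close> and
  density of the rationals extend the formula to the whole segment.\<close>

lemma zero_inside_segment:
  assumes f: "frame w v A B" and z: "zero_inside w v" and t: "t \<in> {0..1}"
  shows "h (pt (of_real (1 - t) * w + of_real t * v)) = pt (of_real (1 - t) * A + of_real t * B)"
proof -
  have d: "vdet w v = 1" "vdet A B = 1" using f by (auto simp: frame_def)
  have rat: "h (pt (of_real (1 - t) * w + of_real t * v)) = pt (of_real (1 - t) * A + of_real t * B)"
    if t: "t \<in> \<rat>" "0 \<le> t" "t \<le> 1" for t
  proof -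
    obtain p q where pq: "q \<noteq> 0" "\<bar>t\<bar> = real p / real q" "coprime p q"
      using Rats_abs_nat_div_natE[OF t(1)] by blast
    then have t': "t = real p / real q" using t by simp
    then have le: "p \<le> q" using t(3) pq(1) by (simp add: divide_le_eq)
    then have "coprime (q - p) p" using pq(3)
      by (simp add: coprime_iff_gcd_eq_1 gcd.commute[of p] gcd_diff1_nat)
    from zero_inside_nat_combination[OF f z this]
    have 1: "h (pt (of_nat (q - p) * w + of_nat p * v)) = pt (of_nat (q - p) * A + of_nat p * B)" .
    have "of_nat (q - p) * x + of_nat p * y = of_real (real q) * (of_real (1 - t) * x + of_real t * y)" for x y :: complex
    proof -
      have "of_real (real q) * (of_real (1 - t) * x + of_real t * y) =
        of_real (real q * (1 - t)) * x + of_real (real q * t) * y" by (simp only: of_real_mult distrib_left mult.assoc)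
      moreover have "real q * (1 - t) = real (q - p)" "real q * t = real p"
        using le pq(1) by (simp_all add: t' of_nat_diff field_simps)
      ultimately show ?thesis by (simp only: of_real_of_nat_eq)
    qed
    with 1 have "h (pt (of_real (real q) * (of_real (1 - t) * w + of_real t * v)))
      = pt (of_real (real q) * (of_real (1 - t) * A + of_real t * B))" by (simp only:)
    then show ?thesis using pt_scale[of "real q"] pq(1) by (metis of_nat_eq_0_iff)
  qed
  have cont_pt: "continuous_on {0..1} (\<lambda>t. pt (of_real (1 - t) * x + of_real t * y))"
    if "vdet x y = 1" for x y
    unfolding pt_def
    by (intro continuous_intros) (use segment_nonzero[OF that] in \<open>simp only: complex_cnj_zero_iff, blast\<close>)
  have "continuous_on {0..1} (\<lambda>t. h (pt (of_real (1 - t) * w + of_real t * v)))"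
    by (rule continuous_on_compose2[OF continuous_h cont_pt[OF d(1)]])
      (use segment_nonzero[OF d(1)] in \<open>auto simp: norm_pt\<close>)
  then have cont: "continuous_on {0..1} (\<lambda>t. h (pt (of_real (1 - t) * w + of_real t * v))
      - pt (of_real (1 - t) * A + of_real t * B))"
    by (intro continuous_on_diff cont_pt[OF d(2)])
  have cl: "closure ({0<..<1::real} \<inter> \<rat>) = {0..1}"
  proof -
    have "closure ({0<..<1::real} \<inter> \<rat>) = closure {0<..<1}"
      by (rule closure_open_Int_superset) (simp_all add: Rats_closure_real)
    then show ?thesis by simp
  qed
  have "h (pt (of_real (1 - t) * w + of_real t * v)) - pt (of_real (1 - t) * A + of_real t * B) = 0"
    by (rule continuous_constant_on_closure[of "{0<..<1::real} \<inter> \<rat>", unfolded cl, OF cont _ t])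
      (use rat in auto)
  then show ?thesis by simp
qed

lemma zero_inside_moebius:
  assumes "gauss_int w" "gauss_int v" "vdet w v = 1" "zero_inside w v"
    and w: "w = of_real r * cis (a / 2)" "r > 0" and v: "v = of_real s * cis (b / 2)" "s > 0"
    and ab: "a < b" "b < a + 2 * pi"
  shows "\<exists>g\<in>PSU11. \<forall>x\<in>{a..b}. h (cis x) = g (cis x)"
proof -
  obtain A B where f: "frame w v A B" using frame_exists assms by blast
  then obtain \<alpha> \<beta> where m: "(norm \<alpha>)\<^sup>2 - (norm \<beta>)\<^sup>2 = 1" "rlinear \<alpha> \<beta> w = A" "rlinear \<alpha> \<beta> v = B"
    using rlinear_exists unfolding frame_def by metis
  have "h (cis x) = moebius \<alpha> \<beta> (cis x)" if x: "x \<in> {a..b}" for x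
  proof -
    obtain t k where t: "0 \<le> t" "t \<le> 1" "k > 0"
      and c: "cis (x / 2) = of_real k * (of_real (1 - t) * w + of_real t * v)"
      using cone_angle[OF w v assms(3), of x] ab x by auto
    have "cis x = pt (cis (x / 2))" by (simp add: pt_cis)
    also have "\<dots> = pt (of_real (1 - t) * w + of_real t * v)" unfolding c using t by (simp add: pt_scale)
    finally have cx: "cis x = pt (of_real (1 - t) * w + of_real t * v)" .
    have "h (cis x) = pt (of_real (1 - t) * A + of_real t * B)"
      unfolding cx using zero_inside_segment[OF f assms(4)] t by simp
    also have "\<dots> = pt (rlinear \<alpha> \<beta> (of_real (1 - t) * w + of_real t * v))"
      unfolding rlinear_lincomb m ..
    also have "\<dots> = moebius \<alpha> \<beta> (cis x)" unfolding cx by (rule pt_rlinear[OF segment_nonzero[OF assms(3)]])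
    finally show ?thesis .
  qed
  then show ?thesis using moebius_PSU11[OF m(1)] by blast
qed

end


section \<open>Finitely many shears\<close>

text \<open>Breakpoints are given by real angles rather than points of the circle, so that chains
  can be translated by full turns and run around the circle several times.\<close>

inductive Moebius_chain :: "(complex \<Rightarrow> complex) \<Rightarrow> real \<Rightarrow> real \<Rightarrow> bool" for h where
  piece: "\<lbrakk>a < b; cis a \<in> farey_vertices; cis b \<in> farey_vertices; g \<in> PSU11;
      \<And>x. x \<in> {a..b} \<Longrightarrow> h (cis x) = g (cis x)\<rbrakk> \<Longrightarrow> Moebius_chain h a b"
| join: "\<lbrakk>Moebius_chain h a b; Moebius_chain h b c\<rbrakk> \<Longrightarrow> Moebius_chain h a c"

lemma Moebius_chain_less: "Moebius_chain h a b \<Longrightarrow> a < b"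
  by (induction rule: Moebius_chain.induct) auto

lemma Moebius_chain_shift:
  assumes "Moebius_chain h a b" "cis c = 1" shows "Moebius_chain h (a + c) (b + c)"
  using assms(1)
proof induction
  case (piece a b g)
  have c: "cis (x + c) = cis x" for x using assms(2) by (simp flip: cis_mult)
  have "h (cis x) = g (cis x)" if "x \<in> {a + c..b + c}" for x
    using piece(5)[of "x - c"] that c[of "x - c"] by simp
  then show ?case using piece(1-4) by (intro Moebius_chain.piece[of _ _ g]) (simp_all add: c)
qed (rule Moebius_chain.join)

lemma Moebius_chain_right:
  assumes "Moebius_chain h a b" "a \<le> x" "x < b"
  shows "\<exists>\<epsilon>>0. \<exists>g\<in>PSU11. \<forall>y\<in>{x..x + \<epsilon>}. h (cis y) = g (cis y)"
  using assms
proof induction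
  case (piece a b g)
  then show ?case by (intro exI[of _ "b - x"]) auto
next
  case (join a b c)
  then show ?case by (cases "x < b") auto
qed

lemma Moebius_chain_left:
  assumes "Moebius_chain h a b" "a < x" "x \<le> b"
  shows "\<exists>\<epsilon>>0. \<exists>g\<in>PSU11. \<forall>y\<in>{x - \<epsilon>..x}. h (cis y) = g (cis y)"
  using assms
proof induction
  case (piece a b g)
  then show ?case by (intro exI[of _ "x - a"]) auto
next
  case (join a b c)
  then show ?case by (cases "x \<le> b") auto
qed

text \<open>Only left endpoints are listed, because after a full turn the last right endpoint is
  again the first breakpoint.\<close>

lemma Moebius_chain_list:
  assumes "Moebius_chain h a b"
  shows "\<exists>ts. ts \<noteq> [] \<and> hd ts = a \<and> sorted_wrt (<) ts \<and>
    (\<forall>t\<in>set ts. a \<le> t \<and> t < b \<and> cis t \<in> farey_vertices) \<and>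
    (\<forall>i<length ts. \<exists>g\<in>PSU11. \<forall>x\<in>{ts ! i..(ts @ [b]) ! Suc i}. h (cis x) = g (cis x))"
  using assms
proof induction
  case (piece a b g)
  then show ?case by (intro exI[of _ "[a]"]) auto
next
  case (join a b c)
  obtain ts where ts: "ts \<noteq> []" "hd ts = a" "sorted_wrt (<) ts"
    "\<forall>t\<in>set ts. a \<le> t \<and> t < b \<and> cis t \<in> farey_vertices"
    "\<forall>i<length ts. \<exists>g\<in>PSU11. \<forall>x\<in>{ts ! i..(ts @ [b]) ! Suc i}. h (cis x) = g (cis x)"
    using join.IH(1) by blast
  obtain us where us: "us \<noteq> []" "hd us = b" "sorted_wrt (<) us"
    "\<forall>t\<in>set us. b \<le> t \<and> t < c \<and> cis t \<in> farey_vertices"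
    "\<forall>i<length us. \<exists>g\<in>PSU11. \<forall>x\<in>{us ! i..(us @ [c]) ! Suc i}. h (cis x) = g (cis x)"
    using join.IH(2) by blast
  have ab: "a < b" "b < c" using join.hyps Moebius_chain_less by auto
  show ?case
  proof (intro exI[of _ "ts @ us"] conjI)
    show "sorted_wrt (<) (ts @ us)" using ts(3,4) us(3,4) unfolding sorted_wrt_append by (meson less_le_trans)
    show "\<forall>t\<in>set (ts @ us). a \<le> t \<and> t < c \<and> cis t \<in> farey_vertices"
      unfolding set_append using ts(4) us(4) ab by (meson UnE less_imp_le less_trans order_trans)
    show "\<forall>i<length (ts @ us). \<exists>g\<in>PSU11. \<forall>x\<in>{(ts @ us) ! i..((ts @ us) @ [c]) ! Suc i}. h (cis x) = g (cis x)"
    proof (intro allI impI)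
      fix i assume i: "i < length (ts @ us)"
      show "\<exists>g\<in>PSU11. \<forall>x\<in>{(ts @ us) ! i..((ts @ us) @ [c]) ! Suc i}. h (cis x) = g (cis x)"
      proof (cases "i < length ts")
        case True
        have "((ts @ us) @ [c]) ! Suc i = (ts @ [b]) ! Suc i"
        proof (cases "Suc i = length ts")
          case True
          then show ?thesis using us(1,2) by (simp add: nth_append hd_conv_nth)
        next
          case False
          then have "Suc i < length ts" using \<open>i < length ts\<close> by simp
          then show ?thesis by (simp add: nth_append)
        qed
        moreover have "(ts @ us) ! i = ts ! i" using True by (simp add: nth_append)
        ultimately show ?thesis using ts(5) True by metis
      next
        case False
        then obtain j where j: "i = length ts + j" using le_Suc_ex by (metis not_less)
        then have "j < length us" using i by simp
        moreover have "((ts @ us) @ [c]) ! Suc i = (us @ [c]) ! Suc j" "(ts @ us) ! i = us ! j"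
          using j nth_append_length_plus[of ts "us @ [c]" "Suc j"] by simp_all
        ultimately show ?thesis using us(5) by metis
      qed
    qed
  qed (use ts(1,2) in simp_all)
qed

lemma cis_eq_imp_eq:
  assumes "cis s = cis t" "\<bar>s - t\<bar> < 2 * pi" shows "s = t"
proof -
  obtain k where k: "s = t + of_int k * (2 * pi)"
    using sin_cos_eq_iff[of s t] assms(1) by (auto simp: complex_eq_iff mult_ac)
  then have "\<bar>of_int k * (2 * pi)\<bar> < 1 * (2 * pi)" using assms(2) by simp
  then have "\<bar>real_of_int k\<bar> < 1" unfolding abs_mult by simp
  then have "k = 0" by linarith
  then show ?thesis using k by simp
qed

lemma Moebius_chain_piecewise_Moebius:
  assumes "Moebius_chain h a (a + 2 * pi)" shows "piecewise_Moebius farey_vertices h"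
proof -
  let ?b = "a + 2 * pi"
  obtain ts where ts: "ts \<noteq> []" "hd ts = a" "sorted_wrt (<) ts"
    "\<forall>t\<in>set ts. a \<le> t \<and> t < ?b \<and> cis t \<in> farey_vertices"
    "\<forall>i<length ts. \<exists>g\<in>PSU11. \<forall>x\<in>{ts ! i..(ts @ [?b]) ! Suc i}. h (cis x) = g (cis x)"
    using Moebius_chain_list[OF assms] by blast
  let ?n = "length ts"
  have len: "length (ts @ [?b]) = Suc ?n" by simp
  have srt: "sorted_wrt (<) (ts @ [?b])" using ts(3,4) by (simp add: sorted_wrt_append)
  have "\<exists>g\<in>PSU11. \<forall>z\<in>closed_arc (map cis ts ! i) (map cis ts ! (Suc i mod ?n)). h z = g z" if i: "i < ?n" for i
  proof -
    obtain g where g: "g \<in> PSU11" "\<And>x. x \<in> {ts ! i..(ts @ [?b]) ! Suc i} \<Longrightarrow> h (cis x) = g (cis x)"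
      using ts(5) i by blast
    let ?s = "ts ! i" and ?t = "(ts @ [?b]) ! Suc i"
    have st: "?s < ?t" using sorted_wrt_nth_less[OF srt, of i "Suc i"] i by (simp add: nth_append)
    have "?t \<in> set (ts @ [?b])" using i len nth_mem[of "Suc i" "ts @ [?b]"] by linarith
    then have tb: "?t \<le> ?b" using ts(4) by auto
    have sa: "a \<le> ?s" using ts(4) i by simp
    \<comment> \<open>The cyclic successor of the last breakpoint is the first one, which is
      \<open>cis\<close> of the appended angle \<open>a + 2 * pi\<close>.\<close>
    have next': "map cis ts ! (Suc i mod ?n) = cis ?t"
    proof (cases "Suc i = ?n")
      case True
      have "ts ! 0 = a" using ts(1,2) by (simp add: hd_conv_nth)
      then show ?thesis using True ts(1) by (simp add: nth_append flip: cis_mult)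
    next
      case False
      then show ?thesis using i by (simp add: nth_append)
    qed
    have "h z = g z" if z: "z \<in> closed_arc (map cis ts ! i) (map cis ts ! (Suc i mod ?n))" for z
    proof -
      obtain u s where us: "z = cis ?s * cis u" "0 \<le> u" "u \<le> s" "0 < s" "s \<le> 2 * pi"
        "cis ?t = cis ?s * cis s"
        using z i unfolding next' closed_arc_def by auto
      have "cis ?t = cis (?s + s)" using us(6) by (simp add: cis_mult)
      \<comment> \<open>The arc length \<open>s\<close> is a priori known only modulo full turns;
        these bounds identify it with the length of the piece, even when the piece is the whole
        circle.\<close>
      moreover have "\<bar>?t - (?s + s)\<bar> < 2 * pi" using us(4,5) st tb sa by linarith
      ultimately have "?t = ?s + s" by (rule cis_eq_imp_eq)
      then show ?thesis using g(2)[of "?s + u"] us by (simp add: cis_mult)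
    qed
    then show ?thesis using g(1) by blast
  qed
  moreover have "ccw (map cis ts)" unfolding ccw_def
    using ts by (intro exI[of _ ts]) auto
  ultimately show ?thesis unfolding piecewise_Moebius_def
    by (intro exI[of _ "map cis ts"]) (use ts in auto)
qed

section \<open>Growth of vectors under Stern-Brocot subdivision\<close>

lemma polar_next:
  assumes w: "w = of_real r * cis (a / 2)" "r > 0" and d: "vdet w m > 0"
  obtains c q where "m = of_real q * cis (c / 2)" "q > 0" "a < c" "c < a + 2 * pi"
proof -
  have "m \<noteq> 0" using d by auto
  have "norm (m / of_real (norm m)) = 1" using \<open>m \<noteq> 0\<close> by (simp add: norm_divide)
  then obtain s where s: "m / of_real (norm m) = cis s" "a / 2 \<le> s" "s < a / 2 + 2 * pi"
    using cis_lift by blast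
  have m: "m = of_real (norm m) * cis s" using s(1) \<open>m \<noteq> 0\<close> by (simp add: field_simps)
  have "vdet w m = r * norm m * sin (s - a / 2)" using vdet_cis[of r "a / 2" "norm m" s] w(1) m by metis
  moreover have "r * norm m > 0" using w(2) \<open>m \<noteq> 0\<close> by simp
  ultimately have sp: "sin (s - a / 2) > 0" using d by (metis zero_less_mult_pos)
  \<comment> \<open>A positive sine confines the half-angle difference to \<open>(0, pi)\<close>, so
    the doubled angle advances by less than a full turn.\<close>
  then have "s - a / 2 < pi" using s(2,3) sin_le_zero[of "s - a / 2"] by linarith
  moreover have "s \<noteq> a / 2" using sp by auto
  ultimately show ?thesis using that[of "norm m" "2 * s"] s m \<open>m \<noteq> 0\<close> by simp
qed

text \<open>\<open>Re (cnj w * v)\<close> is the Euclidean inner product; when it is nonnegative, so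
  is every term in the expansion of the squared norm.\<close>

lemma norm_combination_ge:
  assumes "Re (cnj w * v) \<ge> 0"
  shows "a \<ge> 1 \<Longrightarrow> norm w \<le> norm (of_nat a * w + of_nat b * v)"
    and "b \<ge> 1 \<Longrightarrow> norm v \<le> norm (of_nat a * w + of_nat b * v)"
proof -
  have e: "(norm (of_nat a * w + of_nat b * v))\<^sup>2 =
    (real a)\<^sup>2 * (norm w)\<^sup>2 + (real b)\<^sup>2 * (norm v)\<^sup>2 + 2 * (real a * real b) * Re (cnj w * v)"
    unfolding cmod_power2 by (simp add: algebra_simps power2_eq_square)
  have p: "0 \<le> 2 * (real a * real b) * Re (cnj w * v)" using assms by simp
  have q: "0 \<le> (real a)\<^sup>2 * (norm w)\<^sup>2" "0 \<le> (real b)\<^sup>2 * (norm v)\<^sup>2" by simp_all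
  show "norm w \<le> norm (of_nat a * w + of_nat b * v)" if "a \<ge> 1"
  proof -
    have "1 * (norm w)\<^sup>2 \<le> (real a)\<^sup>2 * (norm w)\<^sup>2" using that by (intro mult_right_mono) simp_all
    then have "(norm w)\<^sup>2 \<le> (norm (of_nat a * w + of_nat b * v))\<^sup>2" using e p q by linarith
    then show ?thesis by (rule power2_le_imp_le) simp
  qed
  show "norm v \<le> norm (of_nat a * w + of_nat b * v)" if "b \<ge> 1"
  proof -
    have "1 * (norm v)\<^sup>2 \<le> (real b)\<^sup>2 * (norm v)\<^sup>2" using that by (intro mult_right_mono) simp_all
    then have "(norm v)\<^sup>2 \<le> (norm (of_nat a * w + of_nat b * v))\<^sup>2" using e p q by linarith
    then show ?thesis by (rule power2_le_imp_le) simp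
  qed
qed

lemma gauss_int_norm_ge_1:
  assumes "gauss_int w" "w \<noteq> 0" shows "(norm w)\<^sup>2 \<ge> 1"
proof -
  obtain p q where w: "w = Complex (of_int p) (of_int q)" using gintE[OF assms(1)] .
  have "p\<^sup>2 + q\<^sup>2 \<noteq> 0" using assms(2) w by (auto simp: sum_power2_eq_zero_iff complex_eq_iff)
  then have "p\<^sup>2 + q\<^sup>2 \<ge> 1" using zero_le_power2[of p] zero_le_power2[of q] by linarith
  moreover have "(norm w)\<^sup>2 = real_of_int (p\<^sup>2 + q\<^sup>2)" unfolding cmod_power2 w by simp
  ultimately show ?thesis by linarith
qed

text \<open>Since nonzero Gaussian integers have norm at least one, inserting the mediant raises the
  squared product by at least one. This is what makes the subdivision terminate.\<close>

lemma norm_split_ge: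
  assumes "gauss_int w" "gauss_int v" "w \<noteq> 0" "v \<noteq> 0" "Re (cnj w * v) \<ge> 0"
  shows "(norm w * norm v)\<^sup>2 + 1 \<le> (norm w * norm (w + v))\<^sup>2"
    and "(norm w * norm v)\<^sup>2 + 1 \<le> (norm (w + v) * norm v)\<^sup>2"
proof -
  have e: "(norm (w + v))\<^sup>2 = (norm w)\<^sup>2 + (norm v)\<^sup>2 + 2 * Re (cnj w * v)"
    unfolding cmod_power2 by (simp add: algebra_simps power2_eq_square)
  have 1: "(norm w)\<^sup>2 \<ge> 1" "(norm v)\<^sup>2 \<ge> 1" using gauss_int_norm_ge_1 assms by blast+
  then have 2: "(norm w)\<^sup>2 * (norm w)\<^sup>2 \<ge> 1" "(norm v)\<^sup>2 * (norm v)\<^sup>2 \<ge> 1"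
    using mult_mono[OF 1(1) 1(1)] mult_mono[OF 1(2) 1(2)] by simp_all
  have "(norm w)\<^sup>2 * ((norm w)\<^sup>2 + (norm v)\<^sup>2) \<le> (norm w)\<^sup>2 * (norm (w + v))\<^sup>2"
    using e assms(5) by (intro mult_left_mono) simp_all
  then show "(norm w * norm v)\<^sup>2 + 1 \<le> (norm w * norm (w + v))\<^sup>2"
    using 2 by (simp add: power_mult_distrib distrib_left)
  have "((norm w)\<^sup>2 + (norm v)\<^sup>2) * (norm v)\<^sup>2 \<le> (norm (w + v))\<^sup>2 * (norm v)\<^sup>2"
    using e assms(5) by (intro mult_right_mono) simp_all
  then show "(norm w * norm v)\<^sup>2 + 1 \<le> (norm (w + v) * norm v)\<^sup>2"
    using 2 by (simp add: power_mult_distrib distrib_right)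
qed

context oriented_circle_homeo
begin

text \<open>Only the edges with \<open>norm x * norm y\<close> bounded can have nonzero shear, because the length of the
  chord from \<open>pt x\<close> to \<open>pt y\<close> is \<open>2 / (norm x * norm y)\<close>; this product grows under subdivision.\<close>

lemma farey_interval_Moebius_chain:
  fixes N :: real
  assumes bound: "\<And>x y. gauss_int x \<Longrightarrow> gauss_int y \<Longrightarrow> vdet x y = 1 \<Longrightarrow> shear h {pt x, pt y} \<noteq> 0 \<Longrightarrow>
      (norm x * norm y)\<^sup>2 \<le> N"
    and "gauss_int w" "gauss_int v" "vdet w v = 1" "Re (cnj w * v) \<ge> 0"
    and "w = of_real r * cis (a / 2)" "r > 0" "v = of_real s * cis (b / 2)" "s > 0"
    and "a < b" "b < a + 2 * pi" "N < (norm w * norm v)\<^sup>2 + real k"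
  shows "Moebius_chain h a b"
  using assms(2-)
proof (induction k arbitrary: w v r s a b)
  case 0
  \<comment> \<open>For \<open>k = 0\<close> the edge \<open>w, v\<close> already exceeds the bound
    \<open>N\<close>. Edges inside the arc have endpoint vectors at least as long, so their shears
    vanish.\<close>
  have "zero_inside w v" unfolding zero_inside_def
  proof (intro allI impI)
    fix p q x y :: nat assume pq: "p * y = q * x + 1 \<and> q + x > 0"
    then have 1: "p \<ge> 1" "y \<ge> 1" by (auto intro!: Suc_leI gr0I)
    let ?x = "of_nat p * w + of_nat q * v" and ?y = "of_nat x * w + of_nat y * v"
    have "vdet ?x ?y = (real p * real y - real q * real x) * vdet w v"
      by (simp add: vdet_def algebra_simps)
    also have "real p * real y - real q * real x = 1" using pq
      by (metis add_diff_cancel_left' of_nat_1 of_nat_add of_nat_mult)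
    finally have d: "vdet ?x ?y = 1" using 0 by simp
    have "norm w * norm v \<le> norm ?x * norm ?y"
      using norm_combination_ge 0(4) 1 by (intro mult_mono) auto
    then have "(norm w * norm v)\<^sup>2 \<le> (norm ?x * norm ?y)\<^sup>2" by (intro power_mono) auto
    then have "\<not> (norm ?x * norm ?y)\<^sup>2 \<le> N" using 0(11) unfolding of_nat_0 by linarith
    then show "shear h {pt ?x, pt ?y} = 0" using bound[of ?x ?y] 0 d by (meson gauss_int_closed)
  qed
  then obtain g where g: "g \<in> PSU11" "\<And>x. x \<in> {a..b} \<Longrightarrow> h (cis x) = g (cis x)"
    using zero_inside_moebius[of w v r a s b] 0 by blast
  have "cis a = pt w" using 0(5,6) pt_polar[of r "a / 2"] by simp
  moreover have "cis b = pt v" using 0(7,8) pt_polar[of s "b / 2"] by simp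
  moreover have "\<bar>vdet v w\<bar> = 1" using 0(3) by (simp add: vdet_commute[of v w])
  ultimately have "cis a \<in> farey_vertices" "cis b \<in> farey_vertices"
    using 0(1-3) farey_vertexI[of w v] farey_vertexI[of v w] by simp_all
  then show ?case using g 0(9) by (intro Moebius_chain.piece[of a b g]) auto
next
  case (Suc k)
  have nz: "w \<noteq> 0" "v \<noteq> 0" using Suc.prems(3) by auto
  have "vdet w (w + v) > 0" using Suc.prems(3) by (simp add: vdet_add)
  then obtain c q where c: "w + v = of_real q * cis (c / 2)" "q > 0" "a < c" "c < a + 2 * pi"
    using polar_next[OF Suc.prems(5,6)] by blast
  have "vdet (w + v) v > 0" using Suc.prems(3) by (simp add: vdet_add)
  then obtain b' s' where b': "v = of_real s' * cis (b' / 2)" "s' > 0" "c < b'" "b' < c + 2 * pi"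
    using polar_next[OF c(1,2)] by blast
  \<comment> \<open>The polar form of \<open>v\<close> found by turning from \<open>w + v\<close>
    coincides with the given one: both moduli are \<open>norm v\<close> and the half-angles differ
    by less than a full turn. This places \<open>c\<close> before \<open>b\<close>.\<close>
  have "norm v = s'" unfolding b'(1) using b'(2) by (simp add: norm_mult)
  moreover have "norm v = s" unfolding Suc.prems(7) using Suc.prems(8) by (simp add: norm_mult)
  ultimately have "cis (b' / 2) = cis (b / 2)" using b'(1,2) Suc.prems(7) by auto
  moreover have "\<bar>b' / 2 - b / 2\<bar> < 2 * pi" using b' c Suc.prems(9,10) by linarith
  ultimately have "b' / 2 = b / 2" by (rule cis_eq_imp_eq)
  then have cb: "c < b" using b' by simp
  note n = norm_split_ge[OF Suc.prems(1,2) nz Suc.prems(4)]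
  have m: "gauss_int (w + v)" "vdet w (w + v) = 1" "vdet (w + v) v = 1"
    using Suc.prems(1-3) by (simp_all add: vdet_add)
  have "Re (cnj w * (w + v)) = (norm w)\<^sup>2 + Re (cnj w * v)" "Re (cnj (w + v) * v) = (norm v)\<^sup>2 + Re (cnj w * v)"
    unfolding cmod_power2 by (simp_all add: algebra_simps power2_eq_square)
  then have re: "Re (cnj w * (w + v)) \<ge> 0" "Re (cnj (w + v) * v) \<ge> 0" using Suc.prems(4) by simp_all
  have N: "N < (norm w * norm (w + v))\<^sup>2 + real k" "N < (norm (w + v) * norm v)\<^sup>2 + real k"
    using Suc.prems(11) n unfolding of_nat_Suc by linarith+
  have "Moebius_chain h a c"
    by (rule Suc.IH[OF Suc.prems(1) m(1,2) re(1) Suc.prems(5,6) c N(1)])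
  moreover have "b < c + 2 * pi" using Suc.prems(10) c by linarith
  then have "Moebius_chain h c b"
    by (rule Suc.IH[OF m(1) Suc.prems(2) m(3) re(2) c(1,2) Suc.prems(7,8) cb _ N(2)])
  ultimately show ?case by (rule Moebius_chain.join)
qed

lemma finite_shears_Moebius_chain:
  assumes "finite {e \<in> farey_edges. shear h e \<noteq> 0}"
  shows "Moebius_chain h 0 (2 * pi)"
proof -
  let ?E = "{e \<in> farey_edges. shear h e \<noteq> 0}"
  have "finite (\<Union> ?E)" using assms by (auto simp: farey_edges_def)
  then have fin: "finite (\<Union> ?E \<times> \<Union> ?E)" by simp
  \<comment> \<open>For a Farey edge the chord has length \<open>2 / (norm x * norm y)\<close>, so
    \<open>F\<close> recovers the squared product from the endpoints. The \<open>0\<close> inserted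
    below keeps the maximum defined when all shears vanish.\<close>
  define F where "F = (\<lambda>(x::complex, y). 4 / (norm (x - y))\<^sup>2)"
  define N where "N = Max (insert 0 (F ` (\<Union> ?E \<times> \<Union> ?E)))"
  have bound: "(norm x * norm y)\<^sup>2 \<le> N"
    if "gauss_int x" "gauss_int y" "vdet x y = 1" "shear h {pt x, pt y} \<noteq> 0" for x y
  proof -
    have "{pt x, pt y} \<in> ?E" using farey_edgeI that by simp
    then have "(pt x, pt y) \<in> \<Union> ?E \<times> \<Union> ?E" by blast
    then have "F (pt x, pt y) \<le> N" unfolding N_def using fin by (intro Max_ge) auto
    moreover have "x \<noteq> 0" "y \<noteq> 0" using that(3) by auto
    then have "F (pt x, pt y) = (norm x * norm y)\<^sup>2"
      unfolding F_def using that(3) by (simp add: norm_pt_diff power_divide)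
    ultimately show ?thesis by simp
  qed
  obtain k where k: "N < real k" using reals_Archimedean2 by blast
  \<comment> \<open>The vectors \<open>1\<close>, \<open>\<i>\<close>, \<open>-1\<close> represent
    the angles \<open>0\<close>, \<open>pi\<close>, \<open>2 * pi\<close>; consecutive ones are
    orthogonal, so the inner product condition holds initially.\<close>
  have "Moebius_chain h 0 pi"
    by (rule farey_interval_Moebius_chain[where w = 1 and v = \<i> and r = 1 and s = 1 and k = k and N = N, OF bound])
      (use k in \<open>auto simp: gauss_int_def vdet_def complex_eq_iff\<close>)
  moreover have "Moebius_chain h pi (2 * pi)"
    by (rule farey_interval_Moebius_chain[where w = \<i> and v = "-1" and r = 1 and s = 1 and k = k and N = N, OF bound])
      (use k in \<open>auto simp: gauss_int_def vdet_def complex_eq_iff\<close>)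
  ultimately show ?thesis by (rule Moebius_chain.join)
qed

end


section \<open>The sum of the shears in a fan\<close>

text \<open>The derivative of \<open>moebius \<alpha> \<beta>\<close> with respect to arclength when
  the determinant is one.\<close>

definition moebius_deriv :: "complex \<Rightarrow> complex \<Rightarrow> complex \<Rightarrow> real" where
  "moebius_deriv \<alpha> \<beta> z = 1 / (norm (cnj \<beta> * z + cnj \<alpha>))\<^sup>2"

text \<open>In homogeneous coordinates the derivative is a ratio of squared lengths, the form in
  which the fan computation produces it.\<close>

lemma moebius_deriv_pt:
  assumes "w \<noteq> 0" shows "moebius_deriv \<alpha> \<beta> (pt w) = (norm w)\<^sup>2 / (norm (rlinear \<alpha> \<beta> w))\<^sup>2"
proof -
  have "cnj \<beta> * pt w + cnj \<alpha> = cnj (rlinear \<alpha> \<beta> w) / cnj w"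
    using assms by (simp add: rlinear_def pt_def field_simps)
  then show ?thesis by (simp add: moebius_deriv_def norm_divide power_divide)
qed

lemma rlinear_nonzero:
  assumes "(norm \<alpha>)\<^sup>2 - (norm \<beta>)\<^sup>2 = 1" "w \<noteq> 0" shows "rlinear \<alpha> \<beta> w \<noteq> 0"
proof
  assume "rlinear \<alpha> \<beta> w = 0"
  then have "vdet w (\<i> * w) = 0" using vdet_rlinear[of \<alpha> \<beta> w "\<i> * w"] assms by simp
  then have "(norm w)\<^sup>2 = 0" unfolding cmod_power2 by (simp add: vdet_def power2_eq_square)
  then show False using assms by simp
qed

lemma pt_mult: "pt (a * b) = pt a * pt b"
  by (simp add: pt_def)

lemma pt_angle:
  assumes "w = of_real r * cis (x / 2)" "r \<noteq> 0" "X \<noteq> 0"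
  shows "pt (w * Complex X Y) = cis (x + 2 * arctan (Y / X))"
proof -
  let ?t = "Y / X"
  have s: "sqrt (1 + ?t\<^sup>2) \<noteq> 0" by (metis power_one sum_power2_gt_zero_iff real_sqrt_eq_zero_cancel_iff less_irrefl zero_neq_one)
  have "Complex X Y = of_real X * (of_real (sqrt (1 + ?t\<^sup>2)) * cis (arctan ?t))"
    using s assms(3) by (simp add: complex_eq_iff cos_arctan sin_arctan)
  then have "pt (Complex X Y) = cis (2 * arctan ?t)"
    using pt_scale[OF assms(3)] pt_polar[OF s] by simp
  moreover have "pt w = cis x" using assms pt_polar[of r "x / 2"] by simp
  ultimately show ?thesis by (simp add: pt_mult cis_mult)
qed

text \<open>Dividing \<open>v + n * w\<close> by \<open>w\<close> gives a number with fixed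
  imaginary part \<open>c > 0\<close> and real part \<open>k + n\<close>. Its argument shrinks as
  \<open>n\<close> grows in modulus, so the neighbours approach \<open>pt w\<close> counterclockwise
  of it for large \<open>n\<close> and clockwise of it for very negative \<open>n\<close>.\<close>

lemma fan_points_near:
  fixes x \<epsilon> r :: real
  assumes w: "w = of_real r * cis (x / 2)" "r \<noteq> 0" and d: "vdet w v = 1" and e: "\<epsilon> > 0"
  shows "\<exists>N::nat. \<forall>n::int. (n \<ge> int N \<longrightarrow> (\<exists>y\<in>{x..x + \<epsilon>}. pt (v + of_int n * w) = cis y)) \<and>
     (n \<le> - int N \<longrightarrow> (\<exists>y\<in>{x - \<epsilon>..x}. pt (v + of_int n * w) = cis y))"
proof -
  have wn: "w \<noteq> 0" using w by simp
  define k c where "k = Re (v / w)" and "c = Im (v / w)"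
  have "c = vdet w v / (norm w)\<^sup>2" unfolding c_def vdet_def Im_divide cmod_power2
    by (simp add: algebra_simps)
  then have c: "c > 0" using d wn by simp
  have p: "pt (v + of_int n * w) = cis (x + 2 * arctan (c / (k + of_int n)))"
    if "k + of_int n \<noteq> 0" for n :: int
  proof -
    have "v + of_int n * w = w * (v / w + of_int n)" using wn by (simp add: field_simps)
    also have "v / w + of_int n = Complex (k + of_int n) c" by (simp add: complex_eq_iff k_def c_def)
    finally show ?thesis using pt_angle[OF w that] by simp
  qed
  have small: "\<bar>2 * arctan (c / X)\<bar> \<le> \<epsilon>" if "\<bar>X\<bar> \<ge> 2 * c / \<epsilon>" "X \<noteq> 0" for X
  proof -
    have "\<bar>2 * arctan (c / X)\<bar> \<le> 2 * \<bar>c / X\<bar>" using abs_arctan_le[of "c / X"] by simp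
    also have "\<dots> \<le> \<epsilon>" using that e c by (simp add: abs_divide field_simps)
    finally show ?thesis .
  qed
  obtain N :: nat where N: "\<bar>k\<bar> + 2 * c / \<epsilon> + 1 \<le> real N" using real_arch_simple by blast
  have pos: "2 * c / \<epsilon> > 0" using c e by simp
  show ?thesis
  proof (intro exI[of _ N] allI conjI impI)
    fix n :: int assume "n \<ge> int N"
    then have "real_of_int n \<ge> real N" by linarith
    then have X: "k + of_int n > 0" "\<bar>k + of_int n\<bar> \<ge> 2 * c / \<epsilon>" using N pos by linarith+
    then have "arctan (c / (k + of_int n)) \<ge> 0" using c by simp
    then show "\<exists>y\<in>{x..x + \<epsilon>}. pt (v + of_int n * w) = cis y"
      using p[of n] small[OF X(2)] X(1) by (intro bexI[of _ "x + 2 * arctan (c / (k + of_int n))"]) auto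
  next
    fix n :: int assume "n \<le> - int N"
    then have "real_of_int n \<le> - real N" by linarith
    then have X: "k + of_int n < 0" "\<bar>k + of_int n\<bar> \<ge> 2 * c / \<epsilon>" using N pos by linarith+
    then have "arctan (c / (k + of_int n)) \<le> 0" using c by (simp add: divide_le_0_iff)
    then show "\<exists>y\<in>{x - \<epsilon>..x}. pt (v + of_int n * w) = cis y"
      using p[of n] small[OF X(2)] X(1) by (intro bexI[of _ "x + 2 * arctan (c / (k + of_int n))"]) auto
  qed
qed

text \<open>Neighbours of \<open>pt w\<close> correspond to the integer solutions \<open>q\<close>
  of \<open>vdet w q = 1\<close>, which form the coset of \<open>v\<close> modulo multiples of
  \<open>w\<close>. The determinant of the solutions with indices \<open>m\<close> and
  \<open>n\<close> is \<open>m - n\<close>, hence injectivity.\<close>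

lemma fan_eq:
  assumes "gauss_int w" "gauss_int v" "vdet w v = 1"
  shows "fan (pt w) = range (\<lambda>n::int. {pt w, pt (v + of_int n * w)})" (is "_ = range ?e")
    and "inj (\<lambda>n::int. {pt w, pt (v + of_int n * w)})"
proof -
  have d: "vdet w (v + of_int n * w) = 1" for n :: int
    using assms(3) vdet_scale(2)[of w "of_int n" w] by (simp add: vdet_add)
  have nz: "w \<noteq> 0" "v + of_int n * w \<noteq> 0" for n :: int using d[of n] by auto
  show "fan (pt w) = range ?e"
  proof (intro equalityI subsetI)
    fix e assume e: "e \<in> fan (pt w)"
    then obtain z where z: "e = {pt w, z}" by (auto simp: fan_def farey_edges_def)
    then have "{pt w, z} \<in> farey_edges" using e by (simp add: fan_def)
    then obtain p q where pq: "gauss_int p" "gauss_int q" "vdet p q = 1" "pt w = pt p" "z = pt q"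
      by (rule farey_edgeE)
    then have "p = w \<or> p = - w" using gauss_int_primitive_unique[of p w q v] assms by simp
    then obtain q' where q': "gauss_int q'" "vdet w q' = 1" "z = pt q'"
      using pq that by (metis vdet_simps(4,5) gauss_int_closed(3) minus_minus pt_uminus)
    obtain n :: int where n: "vdet q' v = of_int n" using gauss_int_vdet[OF q'(1) assms(2)] Ints_cases by blast
    have "q' = of_real (vdet q' v) * w + of_real (vdet w q') * v" by (rule vdet_expand[OF assms(3)])
    then have "q' = v + of_int n * w" using n q'(2) by (simp add: add.commute)
    then show "e \<in> range ?e" using z q'(3) by blast
  next
    fix e assume "e \<in> range ?e"
    then obtain n :: int where "e = ?e n" by blast
    then show "e \<in> fan (pt w)" using farey_edgeI[of w "v + of_int n * w"] assms d by (simp add: fan_def)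
  qed
  show "inj ?e"
  proof (rule injI)
    fix m n :: int assume "?e m = ?e n"
    moreover have "pt w \<noteq> pt (v + of_int m * w)" "pt w \<noteq> pt (v + of_int n * w)"
      using pt_eq_iff nz d by auto
    ultimately have "pt (v + of_int m * w) = pt (v + of_int n * w)" by (auto simp: doubleton_eq_iff)
    then have "vdet (v + of_int m * w) (v + of_int n * w) = 0" using pt_eq_iff nz by blast
    then have "vdet (of_real (of_int m) * w) v + vdet v (of_real (of_int n) * w) + vdet (of_real (of_int m) * w) (of_real (of_int n) * w) = 0"
      by (simp add: vdet_add)
    then have "real_of_int m = real_of_int n"
      unfolding vdet_scale using assms(3) by (simp add: vdet_commute[of v w])
    then show "m = n" by simp
  qed
qed

lemma sum_int_telescope:
  fixes L :: "int \<Rightarrow> real"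
  shows "(\<Sum>n\<in>{- int M..int M}. L (n - 1) - L n) = L (- int M - 1) - L (int M)"
proof (induction M)
  case (Suc M)
  have "{- int (Suc M)..int (Suc M)} = insert (- int (Suc M)) (insert (int (Suc M)) {- int M..int M})"
    by auto
  then have "(\<Sum>n\<in>{- int (Suc M)..int (Suc M)}. L (n - 1) - L n) =
    (L (- int (Suc M) - 1) - L (- int (Suc M))) + ((L (int (Suc M) - 1) - L (int (Suc M))) + (L (- int M - 1) - L (int M)))"
    using Suc by (simp only:) (subst sum.insert; simp)+
  moreover have "- int (Suc M) = - int M - 1" "int (Suc M) - 1 = int M" by simp_all
  ultimately show ?case by (simp only:)
qed simp

context oriented_circle_homeo
begin

lemma fan_shear_sum:
  assumes fin: "finite {e \<in> farey_edges. shear h e \<noteq> 0}"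
    and g: "gauss_int w" "gauss_int v" "vdet w v = 1"
    and w: "w = of_real r * cis (x / 2)" "r \<noteq> 0" and e: "\<epsilon> > 0"
    and R: "(norm \<alpha>)\<^sup>2 - (norm \<beta>)\<^sup>2 = 1" "\<And>y. y \<in> {x..x + \<epsilon>} \<Longrightarrow> h (cis y) = moebius \<alpha> \<beta> (cis y)"
    and L: "(norm \<gamma>)\<^sup>2 - (norm \<delta>)\<^sup>2 = 1" "\<And>y. y \<in> {x - \<epsilon>..x} \<Longrightarrow> h (cis y) = moebius \<gamma> \<delta> (cis y)"
  shows "(\<Sum>e\<in>{e \<in> fan (pt w). shear h e \<noteq> 0}. shear h e) = ln (moebius_deriv \<alpha> \<beta> (cis x)) - ln (moebius_deriv \<gamma> \<delta> (cis x))"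
proof -
  define P where "P n = v + of_int n * w" for n :: int
  define E where "E n = {pt w, pt (P n)}" for n
  have gP: "gauss_int (P n)" for n using g by (simp add: P_def)
  have d: "vdet w (P n) = 1" for n
    using g(3) vdet_scale(2)[of w "of_int n" w] by (simp add: vdet_add P_def)
  have nz: "w \<noteq> 0" "P n \<noteq> 0" for n using d[of n] by auto
  have Psuc: "w + P n = P (n + 1)" "P n - w = P (n - 1)" for n by (simp_all add: P_def algebra_simps)
  have dP: "vdet (P n) (P (n + 1)) = - 1" for n
    unfolding Psuc(1)[symmetric] vdet_add using d[of n] by (simp add: vdet_commute[of "P n" w])
  obtain u where u: "norm u = 1" "u \<noteq> 0" "h (pt w) = pt u" using h_lift[OF nz(1)] .
  have "\<exists>U. U \<noteq> 0 \<and> h (pt (P n)) = pt U" for n using h_lift[OF nz(2)] by metis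
  then obtain U where U: "\<And>n. U n \<noteq> 0" "\<And>n. h (pt (P n)) = pt (U n)" by metis
  \<comment> \<open>Up to a factor independent of \<open>n\<close>, this is the gap between the
    images of consecutive neighbours in an affine coordinate that sends \<open>pt u\<close> to
    infinity. Rescaling the \<open>U n\<close> does not change it.\<close>
  define Y where "Y n = vdet (U n) (U (n + 1)) / (vdet u (U n) * vdet u (U (n + 1)))" for n
  have sh: "shear h (E n) = ln \<bar>Y (n - 1)\<bar> - ln \<bar>Y n\<bar>" for n
  proof -
    define K where "K = (\<lambda>n. vdet u (U (n + 1)) * vdet (U n) (U (n - 1)) / (vdet (U (n + 1)) (U n) * vdet u (U (n - 1))))"
    have s: "shear h (E n) = ln (K n)" for n
      unfolding E_def shear_eq[OF g(1) gP d] Psuc u U K_def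
        cross_ratio_pt[OF u(2) U(1) U(1) U(1)] by simp
    have "farey_quad (E n) (pt w) (pt (P (n + 1))) (pt (P n)) (pt (P (n - 1)))" for n
      using farey_quad_exists[OF g(1) gP d, of n] by (simp add: E_def Psuc)
    then have "ccw [pt u, pt (U (n + 1)), pt (U n), pt (U (n - 1))]" for n
      using ccw4_h unfolding farey_quad_def u(3)[symmetric] U(2)[symmetric] by blast
    then have K: "K n > 0" for n unfolding K_def by (rule vdet_cross_pos[OF u(2) U(1) U(1) U(1)])
    \<comment> \<open>Division by zero yields zero, so a vanishing determinant, even in the
      denominator, would contradict \<open>K (n + 1) > 0\<close>.\<close>
    have nzu: "vdet u (U n) \<noteq> 0" for n using K[of "n + 1"] by (auto simp: K_def)
    have nzU: "vdet (U n) (U (n + 1)) \<noteq> 0" for n using K[of "n + 1"] vdet_commute[of "U n" "U (n + 1)"] by (auto simp: K_def)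
    have nY: "Y n \<noteq> 0" for n using nzu nzU by (simp add: Y_def)
    have "K n = Y (n - 1) / Y n"
      using nzu[of n] nzu[of "n - 1"] nzu[of "n + 1"] nzU[of n]
      by (simp add: K_def Y_def vdet_commute[of "U (n + 1)" "U n"] vdet_commute[of "U n" "U (n - 1)"] mult.commute)
    then have "K n = \<bar>Y (n - 1)\<bar> / \<bar>Y n\<bar>" using K[of n] by (metis abs_divide abs_of_pos)
    then show ?thesis using s nY by (simp add: ln_div)
  qed
  have cx: "cis x = pt w" using w pt_polar[of r "x / 2"] by simp
  \<comment> \<open>No limit is taken: once both neighbours lie where \<open>h\<close> is the
    Moebius map given by \<open>a, b\<close>, the gap has the constant modulus
    \<open>(norm (rlinear a b w))^2\<close>, because the linear map preserves determinants and
    \<open>u\<close> has norm one.\<close>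
  have lim: "ln \<bar>Y n\<bar> = ln ((norm w)\<^sup>2) - ln (moebius_deriv a b (cis x))"
    if ab: "(norm a)\<^sup>2 - (norm b)\<^sup>2 = 1" and hw: "h (pt w) = moebius a b (pt w)"
      and hn: "h (pt (P n)) = moebius a b (pt (P n))" and hn': "h (pt (P (n + 1))) = moebius a b (pt (P (n + 1)))" for a b n
  proof -
    let ?M = "rlinear a b"
    have M0: "?M w \<noteq> 0" "?M (P m) \<noteq> 0" for m using rlinear_nonzero ab nz by blast+
    have dM: "vdet (?M y) (?M z) = vdet y z" for y z using vdet_rlinear[of a b y z] ab by simp
    have "pt u = pt (?M w)" using hw u pt_rlinear nz by simp
    then have "vdet u (?M w) = 0" using pt_eq_iff u(2) M0 by blast
    then obtain l where l: "?M w = of_real l * u" using vdet_zero_imp_scale u(2) by blast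
    have l0: "l \<noteq> 0" using l M0 by auto
    have nl: "(norm (?M w))\<^sup>2 = l\<^sup>2" unfolding l using u(1) by (simp add: norm_mult)
    have "\<exists>c. c \<noteq> 0 \<and> U m = of_real c * ?M (P m)" if "h (pt (P m)) = moebius a b (pt (P m))" for m
    proof -
      have "pt (?M (P m)) = pt (U m)" using that U(2) pt_rlinear nz by metis
      then have "vdet (?M (P m)) (U m) = 0" using pt_eq_iff U(1) M0 by blast
      then obtain c where "U m = of_real c * ?M (P m)" using vdet_zero_imp_scale M0 by blast
      then show ?thesis using U(1)[of m] by auto
    qed
    then obtain c c' where c: "c \<noteq> 0" "U n = of_real c * ?M (P n)"
      and c': "c' \<noteq> 0" "U (n + 1) = of_real c' * ?M (P (n + 1))" using hn hn' by metis
    have "l * vdet u (?M (P m)) = 1" for m using dM[of w "P m"] d[of m] unfolding l vdet_scale by simp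
    then have du: "vdet u (?M (P m)) = 1 / l" for m using l0 by (metis nonzero_mult_div_cancel_left)
    have "Y n = (c * c' * - 1) / ((c * (1 / l)) * (c' * (1 / l)))"
      unfolding Y_def c(2) c'(2) vdet_scale du dM dP by simp
    also have "\<dots> = - l\<^sup>2" using c c' l0 by (simp add: power2_eq_square)
    finally have "\<bar>Y n\<bar> = (norm (?M w))\<^sup>2" using nl by simp
    moreover have "moebius_deriv a b (cis x) = (norm w)\<^sup>2 / (norm (?M w))\<^sup>2" unfolding cx by (rule moebius_deriv_pt[OF nz(1)])
    ultimately show ?thesis using nz M0 by (simp add: ln_div)
  qed
  obtain N where N: "\<And>n. n \<ge> int N \<Longrightarrow> \<exists>y\<in>{x..x + \<epsilon>}. pt (P n) = cis y"
    "\<And>n. n \<le> - int N \<Longrightarrow> \<exists>y\<in>{x - \<epsilon>..x}. pt (P n) = cis y"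
    using fan_points_near[OF w g(3) e] unfolding P_def by metis
  note fan = fan_eq[OF g, folded P_def, folded E_def]
  have "finite {n. shear h (E n) \<noteq> 0}"
  proof (rule finite_imageD[OF _ inj_on_subset[OF fan(2) subset_UNIV]])
    have "E ` {n. shear h (E n) \<noteq> 0} \<subseteq> {e \<in> farey_edges. shear h e \<noteq> 0}"
      using fan(1) by (auto simp: fan_def)
    then show "finite (E ` {n. shear h (E n) \<noteq> 0})" using fin finite_subset by blast
  qed
  then have "finite ((\<lambda>n. nat \<bar>n\<bar>) ` {n. shear h (E n) \<noteq> 0})" by simp
  then obtain N' where N': "\<And>n. shear h (E n) \<noteq> 0 \<Longrightarrow> nat \<bar>n\<bar> \<le> N'"
    by (metis (mono_tags, lifting) finite_nat_set_iff_bounded_le imageI mem_Collect_eq)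
  \<comment> \<open>Beyond \<open>N\<close> the neighbours lie in the two Moebius pieces next to
    \<open>pt w\<close>, and beyond \<open>N'\<close> the shears vanish.\<close>
  define M where "M = max N N'"
  have "{e \<in> fan (pt w). shear h e \<noteq> 0} = E ` {n. shear h (E n) \<noteq> 0}" unfolding fan by auto
  then have "(\<Sum>e\<in>{e \<in> fan (pt w). shear h e \<noteq> 0}. shear h e) = (\<Sum>n\<in>{n. shear h (E n) \<noteq> 0}. shear h (E n))"
    by (simp add: sum.reindex inj_on_subset[OF fan(2) subset_UNIV])
  also have "\<dots> = (\<Sum>n\<in>{- int M..int M}. shear h (E n))"
  proof (rule sum.mono_neutral_left)
    show "{n. shear h (E n) \<noteq> 0} \<subseteq> {- int M..int M}"
    proof
      fix n assume "n \<in> {n. shear h (E n) \<noteq> 0}"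
      then have "nat \<bar>n\<bar> \<le> M" using N'[of n] by (simp add: M_def)
      then show "n \<in> {- int M..int M}" by auto
    qed
  qed auto
  also have "\<dots> = ln \<bar>Y (- int M - 1)\<bar> - ln \<bar>Y (int M)\<bar>"
    unfolding sh by (rule sum_int_telescope)
  also have "ln \<bar>Y (int M)\<bar> = ln ((norm w)\<^sup>2) - ln (moebius_deriv \<alpha> \<beta> (cis x))"
  proof (rule lim[OF R(1)])
    show "h (pt w) = moebius \<alpha> \<beta> (pt w)" using R(2)[of x] e cx by simp
    have "h (pt (P n)) = moebius \<alpha> \<beta> (pt (P n))" if "n \<ge> int M" for n
      using N(1)[of n] that R(2) by (fastforce simp: M_def)
    then show "h (pt (P (int M))) = moebius \<alpha> \<beta> (pt (P (int M)))"
      "h (pt (P (int M + 1))) = moebius \<alpha> \<beta> (pt (P (int M + 1)))" by simp_all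
  qed
  \<comment> \<open>This gap joins the neighbours with indices \<open>- M - 1\<close> and
    \<open>- M\<close>, both on the left piece.\<close>
  also have "ln \<bar>Y (- int M - 1)\<bar> = ln ((norm w)\<^sup>2) - ln (moebius_deriv \<gamma> \<delta> (cis x))"
  proof (rule lim[OF L(1)])
    show "h (pt w) = moebius \<gamma> \<delta> (pt w)" using L(2)[of x] e cx by simp
    have "h (pt (P n)) = moebius \<gamma> \<delta> (pt (P n))" if "n \<le> - int M" for n
      using N(2)[of n] that L(2) by (fastforce simp: M_def)
    then show "h (pt (P (- int M - 1))) = moebius \<gamma> \<delta> (pt (P (- int M - 1)))"
      "h (pt (P (- int M - 1 + 1))) = moebius \<gamma> \<delta> (pt (P (- int M - 1 + 1)))" by simp_all
  qed
  finally show ?thesis by simp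
qed

end


section \<open>Derivatives with respect to arclength\<close>

lemma moebius_denom_ge:
  assumes "norm z = 1" shows "norm (cnj \<beta> * z + cnj \<alpha>) \<ge> norm \<alpha> - norm \<beta>"
  using norm_triangle_ineq4[of "cnj \<beta> * z + cnj \<alpha>" "cnj \<beta> * z"] assms by (simp add: norm_mult)

lemma PSU11_norm_less: "(norm \<alpha>)\<^sup>2 - (norm \<beta>)\<^sup>2 = 1 \<Longrightarrow> norm \<beta> < norm \<alpha>" for \<alpha> \<beta> :: complex
  by (rule power2_less_imp_less) simp_all

lemma moebius_denom_nonzero:
  assumes "(norm \<alpha>)\<^sup>2 - (norm \<beta>)\<^sup>2 = 1" "norm z = 1" shows "cnj \<beta> * z + cnj \<alpha> \<noteq> 0"
  using moebius_denom_ge[OF assms(2), of \<alpha> \<beta>] PSU11_norm_less[OF assms(1)] by auto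

lemma moebius_deriv_pos:
  assumes "(norm \<alpha>)\<^sup>2 - (norm \<beta>)\<^sup>2 = 1" "norm z = 1" shows "moebius_deriv \<alpha> \<beta> z > 0"
  using moebius_denom_nonzero[OF assms] by (simp add: moebius_deriv_def)

lemma norm_moebius:
  assumes "(norm \<alpha>)\<^sup>2 - (norm \<beta>)\<^sup>2 = 1" "norm z = 1" shows "norm (moebius \<alpha> \<beta> z) = 1"
proof -
  obtain w where w: "norm w = 1" "pt w = z" using pt_surj[OF assms(2)] .
  then have "w \<noteq> 0" by auto
  then have "moebius \<alpha> \<beta> z = pt (rlinear \<alpha> \<beta> w)" using pt_rlinear w by simp
  then show ?thesis using norm_pt rlinear_nonzero[OF assms(1) \<open>w \<noteq> 0\<close>] by simp
qed

lemma cis_has_vector_derivative: "(cis has_vector_derivative \<i> * cis x) (at x within S)"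
proof -
  have "((\<lambda>x. cis x) has_vector_derivative 1 *\<^sub>R (\<i> * cis x)) (at x within S)"
    unfolding has_vector_derivative_def
    by (rule has_derivative_eq_rhs[OF has_derivative_cis[OF has_derivative_ident]]) (auto simp: fun_eq_iff)
  then show ?thesis by simp
qed

lemma moebius_cis_has_vector_derivative:
  assumes "(norm \<alpha>)\<^sup>2 - (norm \<beta>)\<^sup>2 = 1"
  shows "((\<lambda>t. moebius \<alpha> \<beta> (cis t)) has_vector_derivative
    of_real (moebius_deriv \<alpha> \<beta> (cis x)) * (\<i> * moebius \<alpha> \<beta> (cis x))) (at x within S)"
proof -
  define z where "z = cis x"
  define q where "q = cnj \<beta> * z + cnj \<alpha>"
  have z: "norm z = 1" "z * cnj z = 1" by (simp_all add: z_def cis_cnj cis_mult)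
  have q: "q \<noteq> 0" unfolding q_def by (rule moebius_denom_nonzero[OF assms z(1)])
  have ab: "\<alpha> * cnj \<alpha> - \<beta> * cnj \<beta> = 1" using assms by (metis complex_norm_square of_real_1 of_real_diff)
  have 1: "(moebius \<alpha> \<beta> has_field_derivative 1 / (q * q)) (at z)"
  proof -
    have "(moebius \<alpha> \<beta> has_field_derivative (\<alpha> * q - (\<alpha> * z + \<beta>) * cnj \<beta>) / (q * q)) (at z)"
      unfolding moebius_def[abs_def] q_def using q[unfolded q_def]
      by (auto intro!: derivative_eq_intros)
    moreover have "\<alpha> * q - (\<alpha> * z + \<beta>) * cnj \<beta> = 1" unfolding ab[symmetric] q_def by (simp add: algebra_simps)
    ultimately show ?thesis by simp
  qed
  have "((moebius \<alpha> \<beta> \<circ> cis) has_vector_derivative (\<i> * z * (1 / (q * q)))) (at x within S)"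
    using field_vector_diff_chain_within[OF cis_has_vector_derivative[of x S]] 1
    unfolding z_def by (metis has_field_derivative_at_within)
  moreover have "\<i> * z * (1 / (q * q)) = of_real (moebius_deriv \<alpha> \<beta> z) * (\<i> * moebius \<alpha> \<beta> z)"
  proof -
    \<comment> \<open>On the circle the numerator of \<open>moebius\<close> is
      \<open>z * cnj q\<close>. Hence the complex derivative \<open>1 / (q * q)\<close> becomes a
      positive multiple of the tangent vector at the image.\<close>
    have "z * cnj q = \<beta> * (z * cnj z) + \<alpha> * z" unfolding q_def by (simp add: algebra_simps)
    then have n: "\<alpha> * z + \<beta> = z * cnj q" using z by simp
    have "of_real (moebius_deriv \<alpha> \<beta> z) = 1 / (q * cnj q)"
      unfolding moebius_deriv_def q_def[symmetric] by (metis complex_norm_square of_real_1 of_real_divide)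
    then show ?thesis using q unfolding moebius_def q_def[symmetric] n by (simp add: divide_simps mult_ac)
  qed
  ultimately show ?thesis by (simp add: o_def z_def)
qed

lemma has_vector_derivative_shift:
  fixes c :: real
  shows "((\<lambda>t. F (c + t)) has_vector_derivative D) (at x) \<longleftrightarrow> (F has_vector_derivative D) (at (c + x))"
proof -
  have 1: "((\<lambda>t. G (c + t)) has_vector_derivative D) (at x)"
    if "(G has_vector_derivative D) (at (c + x))" for G :: "real \<Rightarrow> 'a" and c x
  proof -
    have "((\<lambda>t. c + t) has_vector_derivative 1) (at x)" by (auto intro!: derivative_eq_intros)
    from vector_diff_chain_at[OF this that] show ?thesis by (simp add: o_def)
  qed
  show ?thesis using 1[of F c x] 1[of "\<lambda>t. F (c + t)" "- c" "c + x"] by auto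
qed

lemma has_arc_derivative_cis:
  "has_arc_derivative h d (cis x) \<longleftrightarrow>
    ((\<lambda>t. h (cis t)) has_vector_derivative of_real d * (\<i> * h (cis x))) (at x)"
  using has_vector_derivative_shift[of "\<lambda>t. h (cis t)" x _ 0]
  by (simp add: has_arc_derivative_def cis_mult)

lemma arc_deriv_eq:
  assumes "has_arc_derivative h d \<zeta>" "h \<zeta> \<noteq> 0" shows "arc_deriv h \<zeta> = d"
  unfolding arc_deriv_def
proof (rule the_equality[where P = "\<lambda>d. has_arc_derivative h d \<zeta>", OF assms(1)])
  fix d' assume "has_arc_derivative h d' \<zeta>"
  then have "of_real d' * (\<i> * h \<zeta>) = of_real d * (\<i> * h \<zeta>)"
    using assms(1) unfolding has_arc_derivative_def by (rule vector_derivative_unique_at)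
  then show "d' = d" using assms(2) by simp
qed

text \<open>Derivatives within a nondegenerate closed interval are unique, so the formula also holds
  at the ends of a piece, provided the derivative exists there.\<close>

lemma arc_deriv_on_piece:
  assumes m: "(norm \<alpha>)\<^sup>2 - (norm \<beta>)\<^sup>2 = 1" and h: "\<And>y. y \<in> {a..b} \<Longrightarrow> h (cis y) = moebius \<alpha> \<beta> (cis y)"
    and x: "a < b" "x \<in> {a..b}" and d: "has_arc_derivative h d (cis x)"
  shows "d = moebius_deriv \<alpha> \<beta> (cis x)" "arc_deriv h (cis x) = moebius_deriv \<alpha> \<beta> (cis x)"
proof -
  have D1: "((\<lambda>t. h (cis t)) has_vector_derivative of_real d * (\<i> * h (cis x))) (at x within {a..b})"
    using d unfolding has_arc_derivative_cis by (rule has_vector_derivative_at_within)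
  have D2: "((\<lambda>t. h (cis t)) has_vector_derivative of_real (moebius_deriv \<alpha> \<beta> (cis x)) * (\<i> * h (cis x))) (at x within {a..b})"
    unfolding h[OF x(2)]
    by (rule has_vector_derivative_transform[OF x(2) _ moebius_cis_has_vector_derivative[OF m]]) (use h in simp)
  have "of_real d * (\<i> * h (cis x)) = of_real (moebius_deriv \<alpha> \<beta> (cis x)) * (\<i> * h (cis x))"
    by (rule vector_derivative_unique_within_closed_interval[of a b x, unfolded cbox_interval, OF x D1 D2])
  moreover have nz: "h (cis x) \<noteq> 0" using norm_moebius[OF m, of "cis x"] h[OF x(2)] by force
  ultimately show 1: "d = moebius_deriv \<alpha> \<beta> (cis x)" by simp
  show "arc_deriv h (cis x) = moebius_deriv \<alpha> \<beta> (cis x)" using arc_deriv_eq[OF d nz] 1 by simp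
qed

text \<open>Both formulas give the same value at \<open>x\<close> and the same one-sided derivative,
  so the limits from the two sides combine.\<close>

lemma has_arc_derivative_glue:
  assumes R: "(norm \<alpha>)\<^sup>2 - (norm \<beta>)\<^sup>2 = 1" "\<And>y. y \<in> {x..x + \<epsilon>} \<Longrightarrow> h (cis y) = moebius \<alpha> \<beta> (cis y)"
    and L: "(norm \<gamma>)\<^sup>2 - (norm \<delta>)\<^sup>2 = 1" "\<And>y. y \<in> {x - \<epsilon>..x} \<Longrightarrow> h (cis y) = moebius \<gamma> \<delta> (cis y)"
    and e: "\<epsilon> > 0" and eq: "moebius_deriv \<alpha> \<beta> (cis x) = moebius_deriv \<gamma> \<delta> (cis x)"
  shows "has_arc_derivative h (moebius_deriv \<alpha> \<beta> (cis x)) (cis x)"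
proof -
  let ?D = "of_real (moebius_deriv \<alpha> \<beta> (cis x)) * (\<i> * h (cis x))"
  have xi: "x \<in> {x..x + \<epsilon>}" "x \<in> {x - \<epsilon>..x}" using e by auto
  have r: "((\<lambda>t. h (cis t)) has_vector_derivative ?D) (at x within {x..x + \<epsilon>})"
    unfolding R(2)[OF xi(1)]
    by (rule has_vector_derivative_transform[OF xi(1) _ moebius_cis_has_vector_derivative[OF R(1)]]) (use R(2) in simp)
  have l: "((\<lambda>t. h (cis t)) has_vector_derivative ?D) (at x within {x - \<epsilon>..x})"
    unfolding L(2)[OF xi(2)] eq
    by (rule has_vector_derivative_transform[OF xi(2) _ moebius_cis_has_vector_derivative[OF L(1)]]) (use L(2) in simp)
  have "((\<lambda>t. h (cis t)) has_vector_derivative ?D) (at x within {x - \<epsilon>..x} \<union> {x..x + \<epsilon>})"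
    using l r unfolding has_vector_derivative_def has_derivative_within
    unfolding at_within_union by (blast intro: filterlim_sup)
  moreover have "{x - \<epsilon>..x} \<union> {x..x + \<epsilon>} = {x - \<epsilon>..x + \<epsilon>}" using e by auto
  moreover have "at x within {x - \<epsilon>..x + \<epsilon>} = at x" using e by (intro at_within_interior) simp
  ultimately show ?thesis unfolding has_arc_derivative_cis by simp
qed

lemma has_arc_derivative_interior:
  assumes m: "(norm \<alpha>)\<^sup>2 - (norm \<beta>)\<^sup>2 = 1" and h: "\<And>y. y \<in> {a..b} \<Longrightarrow> h (cis y) = moebius \<alpha> \<beta> (cis y)"
    and x: "a < x" "x < b"
  shows "has_arc_derivative h (moebius_deriv \<alpha> \<beta> (cis x)) (cis x)" "arc_deriv h (cis x) = moebius_deriv \<alpha> \<beta> (cis x)"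
proof -
  show 1: "has_arc_derivative h (moebius_deriv \<alpha> \<beta> (cis x)) (cis x)"
    by (rule has_arc_derivative_glue[OF m _ m, of x "min (x - a) (b - x)"]) (use x h in auto)
  show "arc_deriv h (cis x) = moebius_deriv \<alpha> \<beta> (cis x)"
    by (rule arc_deriv_on_piece(2)[OF m h _ _ 1]) (use x in auto)
qed

section \<open>Chord estimates and Lipschitz bounds for the logarithm of the derivative\<close>

lemma norm_cis_diff: "norm (cis s - cis t) = 2 * \<bar>sin ((s - t) / 2)\<bar>"
proof -
  have "(norm (cis s - cis t))\<^sup>2 = 2 - 2 * cos (s - t)"
    unfolding cmod_power2 by (simp add: cos_diff power2_eq_square algebra_simps)
  also have "\<dots> = (2 * \<bar>sin ((s - t) / 2)\<bar>)\<^sup>2"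
    using cos_double_sin[of "(s - t) / 2", unfolded mult_2 field_sum_of_halves] by (simp add: power_mult_distrib)
  finally show ?thesis by (rule power2_eq_imp_eq) simp_all
qed

lemma norm_cis_diff_le: "norm (cis s - cis t) \<le> \<bar>s - t\<bar>"
  using abs_sin_x_le_abs_x[of "(s - t) / 2"] by (simp add: norm_cis_diff)

text \<open>For the half-angle \<open>y\<close>, at most \<open>2\<close>, the Taylor bound on
  \<open>sin y - y\<close> is at most \<open>2 / 3 * y\<close>, leaving
  \<open>sin y \<ge> y / 3\<close>.\<close>

lemma norm_cis_diff_ge:
  assumes "\<bar>s - t\<bar> \<le> pi" shows "\<bar>s - t\<bar> / 3 \<le> norm (cis s - cis t)"
proof -
  define y where "y = \<bar>(s - t) / 2\<bar>"
  have y: "0 \<le> y" "y \<le> 2" using assms pi_less_4 by (simp_all add: y_def)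
  have "\<bar>sin y - y\<bar> \<le> inverse 6 * y ^ 3"
    using Maclaurin_sin_bound[of y 3] y(1) by (simp add: numeral_3_eq_3 sin_coeff_def)
  moreover have "y ^ 3 \<le> 4 * y"
    using mult_right_mono[OF mult_mono[OF y(2) y(2)], of y] y(1) by (simp add: power3_eq_cube)
  ultimately have "\<bar>sin y - y\<bar> \<le> 2 / 3 * y" by simp
  then have "sin y \<ge> y / 3" by linarith
  moreover have "\<bar>sin ((s - t) / 2)\<bar> = \<bar>sin y\<bar>"
    by (simp add: y_def abs_if)
  ultimately show ?thesis unfolding norm_cis_diff using y by (simp add: y_def)
qed

text \<open>The function is \<open>- 2 * ln (q x)\<close>, where \<open>q\<close> has Lipschitz
  constant \<open>norm \<beta>\<close> and is at least
  \<open>norm \<alpha> - norm \<beta> > 0\<close>; \<open>ln t \<le> t - 1\<close> converts this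
  into a bound for the logarithm.\<close>

lemma ln_moebius_deriv_lipschitz:
  assumes m: "(norm \<alpha>)\<^sup>2 - (norm \<beta>)\<^sup>2 = 1"
  shows "(2 * norm \<beta> / (norm \<alpha> - norm \<beta>))-lipschitz_on UNIV (\<lambda>x. ln (moebius_deriv \<alpha> \<beta> (cis x)))"
proof (rule lipschitz_onI)
  let ?m = "norm \<alpha> - norm \<beta>"
  have mp: "?m > 0" using PSU11_norm_less[OF m] by simp
  define q where "q x = norm (cnj \<beta> * cis x + cnj \<alpha>)" for x
  have q: "q x \<ge> ?m" for x unfolding q_def by (rule moebius_denom_ge) simp
  then have qp: "q x > 0" for x using mp less_le_trans by blast
  have ln: "ln (moebius_deriv \<alpha> \<beta> (cis x)) = - 2 * ln (q x)" for x
    using qp[of x] by (simp add: moebius_deriv_def q_def[symmetric] ln_div ln_realpow)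
  have one: "ln (q x) - ln (q y) \<le> norm \<beta> / ?m * \<bar>x - y\<bar>" for x y
  proof -
    have "ln (q x) - ln (q y) = ln (q x / q y)" using qp[of x] qp[of y] by (simp add: ln_div)
    also have "\<dots> \<le> q x / q y - 1" using qp by (intro ln_le_minus_one) simp
    also have "\<dots> = (q x - q y) / q y" using qp[of y] by (simp add: field_simps)
    also have "\<dots> \<le> (norm \<beta> * \<bar>x - y\<bar>) / q y"
    proof (rule divide_right_mono)
      have "q x - q y \<le> norm (cnj \<beta> * (cis x - cis y))"
        using norm_triangle_ineq2[of "cnj \<beta> * cis x + cnj \<alpha>" "cnj \<beta> * cis y + cnj \<alpha>"]
        by (simp add: q_def algebra_simps)
      also have "\<dots> \<le> norm \<beta> * \<bar>x - y\<bar>"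
        using norm_cis_diff_le by (simp add: norm_mult mult_left_mono)
      finally show "q x - q y \<le> norm \<beta> * \<bar>x - y\<bar>" .
    qed (use qp[of y] in simp)
    also have "\<dots> \<le> (norm \<beta> * \<bar>x - y\<bar>) / ?m"
      using q[of y] mp by (intro divide_left_mono) (auto intro: mult_pos_pos qp)
    finally show ?thesis by simp
  qed
  show "dist (ln (moebius_deriv \<alpha> \<beta> (cis x))) (ln (moebius_deriv \<alpha> \<beta> (cis y))) \<le> 2 * norm \<beta> / ?m * dist x y" for x y
  proof -
    have "dist (ln (moebius_deriv \<alpha> \<beta> (cis x))) (ln (moebius_deriv \<alpha> \<beta> (cis y))) = 2 * \<bar>ln (q x) - ln (q y)\<bar>"
      unfolding ln dist_real_def by (simp add: abs_if)
    moreover have "\<bar>ln (q x) - ln (q y)\<bar> \<le> norm \<beta> / ?m * \<bar>x - y\<bar>"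
      using one[of x y] one[of y x] by (simp add: abs_le_iff abs_minus_commute)
    ultimately show ?thesis by (simp add: dist_real_def)
  qed
  show "0 \<le> 2 * norm \<beta> / ?m" using mp by simp
qed

lemma lipschitz_on_join:
  fixes f :: "real \<Rightarrow> 'a::metric_space"
  assumes "L-lipschitz_on {a..b} f" "M-lipschitz_on {b..c} f"
  shows "(max L M)-lipschitz_on {a..c} f"
proof -
  have "lipschitz_on (max L M) {a..c} (\<lambda>x. if x \<le> b then f x else f x)"
    by (rule lipschitz_on_concat) (use assms in \<open>auto intro: lipschitz_on_le\<close>)
  then show ?thesis by simp
qed

text \<open>Differentiability everywhere gives the Moebius formula on closed pieces, so neighbouring
  pieces agree at the breakpoint and their Lipschitz bounds can be joined.\<close>

lemma Moebius_chain_lipschitz: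
  assumes "Moebius_chain h a b" and "\<And>x. \<exists>d. has_arc_derivative h d (cis x)"
  shows "\<exists>L. L-lipschitz_on {a..b} (\<lambda>x. ln (arc_deriv h (cis x)))"
  using assms(1)
proof induction
  case (piece a b g)
  obtain \<alpha> \<beta> where m: "(norm \<alpha>)\<^sup>2 - (norm \<beta>)\<^sup>2 = 1" "g = moebius \<alpha> \<beta>" using PSU11_moebius[OF piece(4)] .
  have "ln (arc_deriv h (cis x)) = ln (moebius_deriv \<alpha> \<beta> (cis x))" if "x \<in> {a..b}" for x
    using arc_deriv_on_piece(2)[OF m(1), of a b h x] piece m that assms(2) by metis
  then show ?case using lipschitz_on_subset[OF ln_moebius_deriv_lipschitz[OF m(1)], of "{a..b}"]
    by (metis (no_types, lifting) lipschitz_on_transform subset_UNIV)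
next
  case (join a b c)
  then show ?case using lipschitz_on_join by blast
qed

text \<open>The angle of the second point is chosen within \<open>pi\<close> of the first. It may
  leave \<open>[0, 2 * pi]\<close>, hence the longer interval; the factor \<open>3\<close> comes
  from \<open>norm_cis_diff_ge\<close>.\<close>

lemma circle_lipschitz:
  fixes u :: "complex \<Rightarrow> real"
  assumes "L-lipschitz_on {- (2 * pi)..4 * pi} (\<lambda>x. u (cis x))"
  shows "(3 * L)-lipschitz_on unit_circle u"
proof (rule lipschitz_onI)
  have L: "L \<ge> 0" using assms by (rule lipschitz_on_nonneg)
  then show "3 * L \<ge> 0" by simp
  fix \<zeta> \<xi> assume "\<zeta> \<in> unit_circle" "\<xi> \<in> unit_circle"
  then have n: "norm \<zeta> = 1" "norm \<xi> = 1" by auto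
  obtain s where s: "\<zeta> = cis s" "0 \<le> s" "s < 0 + 2 * pi" using cis_lift[OF n(1), of 0] by blast
  obtain t where t: "\<xi> = cis t" "s - pi \<le> t" "t < s - pi + 2 * pi" using cis_lift[OF n(2), of "s - pi"] by blast
  have "dist (u \<zeta>) (u \<xi>) \<le> L * dist s t"
    unfolding s t by (rule lipschitz_onD[OF assms]) (use s t in auto)
  also have "dist s t \<le> 3 * dist \<zeta> \<xi>"
    using norm_cis_diff_ge[of s t] t(2,3) unfolding s(1) t(1) dist_norm by (simp add: abs_le_iff)
  finally show "dist (u \<zeta>) (u \<xi>) \<le> 3 * L * dist \<zeta> \<xi>" using L by (simp add: mult_left_mono)
qed


section \<open>Regularity classes\<close>

lemma Moebius_chain_endpoints: "Moebius_chain h a b \<Longrightarrow> cis a \<in> farey_vertices \<and> cis b \<in> farey_vertices"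
  by (induction rule: Moebius_chain.induct) auto

lemma Moebius_chain_nonvertex:
  assumes "Moebius_chain h a b" "a < x" "x < b" "cis x \<notin> farey_vertices"
  shows "\<exists>c d. \<exists>g\<in>PSU11. c < x \<and> x < d \<and> (\<forall>y\<in>{c..d}. h (cis y) = g (cis y))"
  using assms
proof induction
  case (piece a b g)
  then show ?case by blast
next
  case (join a b c)
  then have "x \<noteq> b" using Moebius_chain_endpoints by blast
  then show ?case using join by (cases "x < b") auto
qed

section \<open>Consequences of Lipschitz continuity\<close>

lemma abs_continuous_on_lipschitz:
  assumes "L-lipschitz_on S f" shows "abs_continuous_on S f"
  unfolding abs_continuous_on_def
proof (intro allI impI)
  fix \<epsilon> :: real assume e: "\<epsilon> > 0"
  have L: "L \<ge> 0" using assms by (rule lipschitz_on_nonneg)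
  show "\<exists>\<delta>>0. \<forall>\<D> U. \<D> division_of U \<and> U \<subseteq> S \<and> (\<Sum>K\<in>\<D>. Sup K - Inf K) < \<delta> \<longrightarrow>
    (\<Sum>K\<in>\<D>. dist (f (Inf K)) (f (Sup K))) < \<epsilon>"
  \<comment> \<open>Adding one to \<open>L\<close> keeps the quotient meaningful when
    \<open>L = 0\<close>.\<close>
  proof (intro exI[of _ "\<epsilon> / (L + 1)"] conjI allI impI)
    show "\<epsilon> / (L + 1) > 0" using e L by simp
    fix \<D> U assume D: "\<D> division_of U \<and> U \<subseteq> S \<and> (\<Sum>K\<in>\<D>. Sup K - Inf K) < \<epsilon> / (L + 1)"
    have K: "dist (f (Inf K)) (f (Sup K)) \<le> L * (Sup K - Inf K) \<and> 0 \<le> Sup K - Inf K" if "K \<in> \<D>" for K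
    proof -
      note d = division_ofD(2-4)[OF conjunct1[OF D] that]
      obtain a b where "K = cbox a b" using d(3) by blast
      then have ab: "K = {a..b}" "a \<le> b" "K \<subseteq> U" using d(1,2) by auto
      then have "{a..b} \<subseteq> S" using D by blast
      then have "dist (f a) (f b) \<le> L * dist a b" using ab by (intro lipschitz_onD[OF assms]) auto
      then show ?thesis using ab by (simp add: dist_real_def)
    qed
    have "(\<Sum>K\<in>\<D>. dist (f (Inf K)) (f (Sup K))) \<le> (\<Sum>K\<in>\<D>. L * (Sup K - Inf K))"
      using K by (intro sum_mono) blast
    also have "\<dots> = L * (\<Sum>K\<in>\<D>. Sup K - Inf K)" by (simp add: sum_distrib_left)
    also have "\<dots> \<le> (L + 1) * (\<Sum>K\<in>\<D>. Sup K - Inf K)"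
      using K by (intro mult_right_mono sum_nonneg) auto
    also have "\<dots> < \<epsilon>" using D L by (simp add: less_divide_eq mult.commute)
    finally show "(\<Sum>K\<in>\<D>. dist (f (Inf K)) (f (Sup K))) < \<epsilon>" .
  qed
qed

text \<open>The integrand is at most the square of \<open>L\<close> on a square of finite measure;
  on the diagonal it is zero by the convention for division by zero.\<close>

lemma H_half_lipschitz:
  assumes "L-lipschitz_on unit_circle u" shows "H_half u"
  unfolding H_half_def
proof
  have "continuous_on unit_circle u" by (rule lipschitz_on_continuous_on[OF assms])
  then have "continuous_on UNIV (\<lambda>t. u (cis t))"
    by (rule continuous_on_compose2) (auto intro: continuous_intros)
  then show "(\<lambda>t. u (cis t)) \<in> borel_measurable lebesgue"
    by (intro measurable_completion) (simp add: borel_measurable_continuous_onI)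
  have b: "ennreal ((norm (of_real (u (cis x) - u (cis y)) / (cis x - cis y)))\<^sup>2) \<le> ennreal (L\<^sup>2)" for x y
  proof (intro ennreal_leI power_mono)
    have "\<bar>u (cis x) - u (cis y)\<bar> \<le> L * norm (cis x - cis y)"
      using lipschitz_onD[OF assms, of "cis x" "cis y"] by (simp add: dist_norm)
    then show "norm (of_real (u (cis x) - u (cis y)) / (cis x - cis y)) \<le> L"
      using lipschitz_on_nonneg[OF assms]
      by (cases "cis x = cis y") (auto simp: norm_divide divide_le_eq simp del: of_real_diff)
  qed simp
  have "(\<integral>\<^sup>+x\<in>{0..2*pi}. (\<integral>\<^sup>+y\<in>{0..2*pi}.
      ennreal ((norm (of_real (u (cis x) - u (cis y)) / (cis x - cis y)))\<^sup>2) \<partial>lebesgue) \<partial>lebesgue)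
    \<le> (\<integral>\<^sup>+x\<in>{0..2*pi}. (\<integral>\<^sup>+y\<in>{0..2*pi}. ennreal (L\<^sup>2) \<partial>lebesgue) \<partial>lebesgue)"
    by (intro nn_integral_mono mult_right_mono b) auto
  also have "\<dots> = ennreal (L\<^sup>2) * ennreal (2 * pi) * ennreal (2 * pi)"
    by (simp add: nn_integral_cmult_indicator)
  also have "\<dots> < \<infinity>" by (simp add: ennreal_mult_less_top)
  finally show "(\<integral>\<^sup>+x\<in>{0..2*pi}. (\<integral>\<^sup>+y\<in>{0..2*pi}.
      ennreal ((norm (of_real (u (cis x) - u (cis y)) / (cis x - cis y)))\<^sup>2) \<partial>lebesgue) \<partial>lebesgue) < \<infinity>" .
qed

section \<open>Divergence of the double integral at a jump\<close>

lemma nn_integral_inverse_linear: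
  fixes K x0 a b :: real
  assumes "0 < a" "a \<le> b" "K \<ge> 0"
  shows "(\<integral>\<^sup>+x. ennreal (K / (x - x0)) * indicator {x0 + a..x0 + b} x \<partial>lebesgue) = ennreal (K * ln (b / a))"
proof -
  have "(\<integral>\<^sup>+x. ennreal (K / (x - x0)) * indicator {x0 + a..x0 + b} x \<partial>lborel)
    = K * ln (x0 + b - x0) - K * ln (x0 + a - x0)"
  proof (rule nn_integral_FTC_Icc)
    fix x assume "x \<in> {x0 + a..x0 + b}"
    then have "x - x0 > 0" using assms by simp
    then show "((\<lambda>x. K * ln (x - x0)) has_real_derivative K / (x - x0)) (at x)" "0 \<le> K / (x - x0)"
      using assms by (auto intro!: derivative_eq_intros)
  qed (use assms in auto)
  moreover have "K * ln (b / a) = K * ln b - K * ln a" using assms by (simp add: ln_div right_diff_distrib)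
  ultimately show ?thesis by (simp add: nn_integral_completion)
qed

text \<open>A jump of \<open>u\<close> at \<open>x\<^sub>0\<close> contributes a multiple of \<open>\<integral> dr / r\<close> near \<open>r = 0\<close>; the translation
  \<open>\<tau>\<close> accounts for the point \<open>1\<close> being both ends of the parameter interval.\<close>

lemma not_H_half_jump:
  assumes c: "c > 0" and \<eta>: "0 < \<eta>" "\<eta> \<le> 1"
    and jump: "\<And>x y. x0 < x \<Longrightarrow> x \<le> x0 + \<eta> \<Longrightarrow> x0 - \<eta> \<le> y \<Longrightarrow> y < x0 \<Longrightarrow> c \<le> \<bar>u (cis x) - u (cis y)\<bar>"
    and dom: "0 \<le> x0" "x0 + \<eta> \<le> 2 * pi" "0 \<le> x0 - \<eta> + \<tau>" "x0 + \<tau> \<le> 2 * pi" "cis \<tau> = 1"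
  shows "\<not> H_half u"
proof
  assume H: "H_half u"
  define \<Phi> where "\<Phi> x y = ennreal ((norm (of_real (u (cis x) - u (cis y)) / (cis x - cis y)))\<^sup>2)" for x y
  define I where "I = (\<integral>\<^sup>+x\<in>{0..2*pi}. (\<integral>\<^sup>+y\<in>{0..2*pi}. \<Phi> x y \<partial>lebesgue) \<partial>lebesgue)"
  have Ifin: "I < \<infinity>" using H by (simp add: H_half_def I_def \<Phi>_def)
  define K where "K = c\<^sup>2 / 4"
  have Kp: "K > 0" using c by (simp add: K_def)
  \<comment> \<open>Points at distances \<open>r\<close> and \<open>s \<le> r\<close> on opposite
    sides of the jump have chord at most \<open>2 * r\<close>, while the values of \<open>u\<close>
    differ by at least \<open>c\<close>.\<close>
  have \<Phi>: "ennreal ((c / (2 * r))\<^sup>2) \<le> \<Phi> (x0 + r) (x0 - s + \<tau>)" if r: "0 < s" "s \<le> r" "r \<le> \<eta>" for r s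
  proof -
    have ct: "cis (x0 - s + \<tau>) = cis (x0 - s)" using dom(5) by (simp flip: cis_mult)
    let ?u = "\<bar>u (cis (x0 + r)) - u (cis (x0 - s))\<bar>" and ?n = "norm (cis (x0 + r) - cis (x0 - s))"
    have "?u \<ge> c" by (rule jump) (use r in auto)
    moreover have "?n \<le> 2 * r" using norm_cis_diff_le[of "x0 + r" "x0 - s"] r by simp
    moreover have "cis (x0 + r) \<noteq> cis (x0 - s)"
    proof
      assume "cis (x0 + r) = cis (x0 - s)"
      moreover have "\<bar>x0 + r - (x0 - s)\<bar> < 2 * pi" using r \<eta> pi_gt3 by simp
      ultimately have "x0 + r = x0 - s" by (rule cis_eq_imp_eq)
      then show False using r by simp
    qed
    then have "?n > 0" by simp
    ultimately have "c / (2 * r) \<le> ?u / ?n" using c r by (intro frac_le) auto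
    then show ?thesis unfolding \<Phi>_def ct using c r
      by (intro ennreal_leI power_mono) (auto simp: norm_divide simp del: of_real_diff)
  qed
  \<comment> \<open>Integrating the pointwise bound over the \<open>y\<close> within distance
    \<open>r\<close> to the left of the jump gives \<open>(c / (2 * r))^2 * r\<close>, which is
    \<open>K / r\<close>.\<close>
  have inner: "ennreal (K / r) \<le> (\<integral>\<^sup>+y\<in>{0..2*pi}. \<Phi> (x0 + r) y \<partial>lebesgue)" if r: "0 < r" "r \<le> \<eta>" for r
  proof -
    have "ennreal (K / r) = ennreal ((c / (2 * r))\<^sup>2) * ennreal r"
      using r by (simp add: K_def power_divide power2_eq_square flip: ennreal_mult')
    also have "\<dots> = (\<integral>\<^sup>+y. ennreal ((c / (2 * r))\<^sup>2) * indicator {x0 - r + \<tau>..<x0 + \<tau>} y \<partial>lebesgue)"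
      using r by (simp add: nn_integral_cmult_indicator)
    also have "\<dots> \<le> (\<integral>\<^sup>+y\<in>{0..2*pi}. \<Phi> (x0 + r) y \<partial>lebesgue)"
    proof (rule nn_integral_mono)
      fix y
      show "ennreal ((c / (2 * r))\<^sup>2) * indicator {x0 - r + \<tau>..<x0 + \<tau>} y \<le> \<Phi> (x0 + r) y * indicator {0..2 * pi} y"
      proof (cases "y \<in> {x0 - r + \<tau>..<x0 + \<tau>}")
        case True
        then have "y \<in> {0..2 * pi}" using dom r by auto
        then show ?thesis using True \<Phi>[of "x0 + \<tau> - y" r] r by simp
      qed simp
    qed
    finally show ?thesis .
  qed
  have lower: "ennreal (K * ln (\<eta> / \<delta>)) \<le> I" if d: "0 < \<delta>" "\<delta> \<le> \<eta>" for \<delta>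
  proof -
    have "ennreal (K * ln (\<eta> / \<delta>)) = (\<integral>\<^sup>+x. ennreal (K / (x - x0)) * indicator {x0 + \<delta>..x0 + \<eta>} x \<partial>lebesgue)"
      using nn_integral_inverse_linear[of \<delta> \<eta> K x0] d Kp by simp
    also have "\<dots> \<le> I" unfolding I_def
    proof (rule nn_integral_mono)
      fix x
      show "ennreal (K / (x - x0)) * indicator {x0 + \<delta>..x0 + \<eta>} x
        \<le> (\<integral>\<^sup>+y\<in>{0..2*pi}. \<Phi> x y \<partial>lebesgue) * indicator {0..2 * pi} x"
      proof (cases "x \<in> {x0 + \<delta>..x0 + \<eta>}")
        case True
        then have "x \<in> {0..2 * pi}" using dom d by auto
        then show ?thesis using True inner[of "x - x0"] d by simp
      qed simp
    qed
    finally show ?thesis .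
  qed
  obtain R where R: "I = ennreal R" "R \<ge> 0" using Ifin by (cases I) auto
  \<comment> \<open>With \<open>\<delta> = \<eta> * exp (- n)\<close> the lower bound equals
    \<open>K * n\<close>, which exceeds the supposed finite value \<open>R\<close>.\<close>
  obtain n where n: "R < real n * K" using ex_less_of_nat_mult[OF Kp] by blast
  have "\<eta> * exp (- real n) \<le> \<eta>" using \<eta> by (simp add: mult_le_cancel_left1)
  then have "ennreal (K * ln (\<eta> / (\<eta> * exp (- real n)))) \<le> ennreal R"
    using lower[of "\<eta> * exp (- real n)"] \<eta> R by simp
  moreover have "\<eta> / (\<eta> * exp (- real n)) = exp (real n)" using \<eta> by (simp add: exp_minus inverse_eq_divide)
  ultimately have "ennreal (K * real n) \<le> ennreal R" by simp
  then show False using n R Kp by (simp add: mult.commute)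
qed

section \<open>The three implications\<close>

context oriented_circle_homeo
begin

text \<open>The logarithm of the derivative varies by at most \<open>2 * L\<close> from its value at
  \<open>1\<close>, since the circle has diameter two. So the derivative is bounded,
  \<open>h\<close> is Lipschitz, and absolute continuity follows.\<close>

lemma C11_imp_weil_petersson:
  assumes "C11_homeo h" shows "weil_petersson h"
proof -
  obtain L where L: "L-lipschitz_on unit_circle (\<lambda>\<zeta>. ln (arc_deriv h \<zeta>))"
    using assms by (auto simp: C11_homeo_def)
  have ex: "\<exists>d>0. has_arc_derivative h d (cis t)" for t using assms by (simp add: C11_homeo_def)
  have nh: "norm (h (cis t)) = 1" for t by (simp add: norm_h)
  define D where "D t = arc_deriv h (cis t)" for t
  have D: "D t > 0 \<and> has_arc_derivative h (D t) (cis t)" for t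
    using ex[of t] arc_deriv_eq nh[of t] unfolding D_def by (metis norm_zero zero_neq_one)
  define B where "B = exp (ln (D 0) + 2 * L)"
  have DB: "D t \<le> B" for t
  proof -
    have "\<bar>ln (D t) - ln (D 0)\<bar> \<le> L * norm (cis t - cis 0)"
      using lipschitz_onD[OF L, of "cis t" "cis 0"] by (simp add: dist_norm D_def)
    also have "\<dots> \<le> L * 2" using norm_triangle_ineq4[of "cis t" "cis 0"] lipschitz_on_nonneg[OF L]
      by (intro mult_left_mono) auto
    finally have "ln (D t) \<le> ln (D 0) + 2 * L" by simp
    then have "exp (ln (D t)) \<le> B" unfolding B_def by simp
    then show ?thesis using D[of t] by simp
  qed
  have "B-lipschitz_on UNIV (\<lambda>t. h (cis t))"
  proof (rule lipschitz_onI)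
    show "0 \<le> B" by (simp add: B_def)
    fix s t
    have "norm (h (cis s) - h (cis t)) \<le> B * norm (s - t)"
    proof (rule differentiable_bound[where S = UNIV and f' = "\<lambda>x r. r *\<^sub>R (of_real (D x) * (\<i> * h (cis x)))"])
      fix x :: real
      show "((\<lambda>t. h (cis t)) has_derivative (\<lambda>r. r *\<^sub>R (of_real (D x) * (\<i> * h (cis x))))) (at x within UNIV)"
        using D[of x] by (simp add: has_arc_derivative_cis has_vector_derivative_def)
      show "onorm (\<lambda>r. r *\<^sub>R (of_real (D x) * (\<i> * h (cis x)))) \<le> B"
        using DB[of x] D[of x] nh by (intro onorm_le) (auto simp: norm_mult mult.commute intro: mult_right_mono)
    qed auto
    then show "dist (h (cis s)) (h (cis t)) \<le> B * dist s t" by (simp add: dist_norm)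
  qed
  then have "abs_continuous_on {0..2 * pi} (\<lambda>t. h (cis t))"
    using abs_continuous_on_lipschitz lipschitz_on_subset by (metis subset_UNIV)
  then show ?thesis using ex H_half_lipschitz[OF L] by (simp add: weil_petersson_def)
qed

text \<open>Chains over three turns give every angle in \<open>[0, 2 * pi)\<close> room on both
  sides; the two local Moebius maps are then those of \<open>fan_shear_sum\<close>.\<close>

lemma vertex_sides:
  assumes P: "Moebius_chain h (- (2 * pi)) (4 * pi)" and fin: "finite {e \<in> farey_edges. shear h e \<noteq> 0}"
    and x: "0 \<le> x" "x < 2 * pi" "cis x \<in> farey_vertices"
  obtains \<epsilon> \<alpha> \<beta> \<gamma> \<delta> where "\<epsilon> > 0" "(norm \<alpha>)\<^sup>2 - (norm \<beta>)\<^sup>2 = 1"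
    "\<And>y. y \<in> {x..x + \<epsilon>} \<Longrightarrow> h (cis y) = moebius \<alpha> \<beta> (cis y)"
    "(norm \<gamma>)\<^sup>2 - (norm \<delta>)\<^sup>2 = 1" "\<And>y. y \<in> {x - \<epsilon>..x} \<Longrightarrow> h (cis y) = moebius \<gamma> \<delta> (cis y)"
    "(\<Sum>e\<in>{e \<in> fan (cis x). shear h e \<noteq> 0}. shear h e) = ln (moebius_deriv \<alpha> \<beta> (cis x)) - ln (moebius_deriv \<gamma> \<delta> (cis x))"
proof -
  obtain \<epsilon>1 g1 where 1: "\<epsilon>1 > 0" "g1 \<in> PSU11" "\<And>y. y \<in> {x..x + \<epsilon>1} \<Longrightarrow> h (cis y) = g1 (cis y)"
    using Moebius_chain_right[OF P, of x] x by auto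
  obtain \<epsilon>2 g2 where 2: "\<epsilon>2 > 0" "g2 \<in> PSU11" "\<And>y. y \<in> {x - \<epsilon>2..x} \<Longrightarrow> h (cis y) = g2 (cis y)"
    using Moebius_chain_left[OF P, of x] x by (auto simp: add_pos_nonneg)
  obtain \<alpha> \<beta> where ab: "(norm \<alpha>)\<^sup>2 - (norm \<beta>)\<^sup>2 = 1" "g1 = moebius \<alpha> \<beta>" using PSU11_moebius[OF 1(2)] .
  obtain \<gamma> \<delta> where cd: "(norm \<gamma>)\<^sup>2 - (norm \<delta>)\<^sup>2 = 1" "g2 = moebius \<gamma> \<delta>" using PSU11_moebius[OF 2(2)] .
  define \<epsilon> where "\<epsilon> = min \<epsilon>1 \<epsilon>2"
  have e: "\<epsilon> > 0" using 1 2 by (simp add: \<epsilon>_def)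
  have R: "h (cis y) = moebius \<alpha> \<beta> (cis y)" if "y \<in> {x..x + \<epsilon>}" for y using 1(3)[of y] that ab by (auto simp: \<epsilon>_def)
  have L: "h (cis y) = moebius \<gamma> \<delta> (cis y)" if "y \<in> {x - \<epsilon>..x}" for y using 2(3)[of y] that cd by (auto simp: \<epsilon>_def)
  obtain w v where wv: "gauss_int w" "gauss_int v" "vdet w v = 1" "cis x = pt w" using x(3) by (rule farey_vertexE)
  have "w \<noteq> 0" using wv(3) by auto
  then obtain r where r: "r \<noteq> 0" "w = of_real r * cis (x / 2)" using pt_eq_cis wv(4) by metis
  show ?thesis
    using that[OF e ab(1) R cd(1) L] fan_shear_sum[OF fin wv(1-3) r(2,1) e ab(1) R cd(1) L] wv(4) by simp
qed

lemma weil_petersson_imp_balanced: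
  assumes P: "Moebius_chain h (- (2 * pi)) (4 * pi)" and fin: "finite {e \<in> farey_edges. shear h e \<noteq> 0}"
    and W: "weil_petersson h"
  shows "finite_balanced (shear h)"
  unfolding finite_balanced_def
proof (intro ballI conjI)
  fix z assume z: "z \<in> farey_vertices"
  have "{e \<in> fan z. shear h e \<noteq> 0} \<subseteq> {e \<in> farey_edges. shear h e \<noteq> 0}" by (auto simp: fan_def)
  then show "finite {e \<in> fan z. shear h e \<noteq> 0}" using fin finite_subset by blast
  have "norm z = 1" using z unfolding farey_vertices_eq by simp
  then obtain x where x: "z = cis x" "0 \<le> x" "x < 2 * pi" using cis_lift[of z 0] by auto
  obtain \<epsilon> \<alpha> \<beta> \<gamma> \<delta> where e: "\<epsilon> > 0" and R: "(norm \<alpha>)\<^sup>2 - (norm \<beta>)\<^sup>2 = 1"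
    "\<And>y. y \<in> {x..x + \<epsilon>} \<Longrightarrow> h (cis y) = moebius \<alpha> \<beta> (cis y)"
    and L: "(norm \<gamma>)\<^sup>2 - (norm \<delta>)\<^sup>2 = 1" "\<And>y. y \<in> {x - \<epsilon>..x} \<Longrightarrow> h (cis y) = moebius \<gamma> \<delta> (cis y)"
    and S: "(\<Sum>e\<in>{e \<in> fan (cis x). shear h e \<noteq> 0}. shear h e) = ln (moebius_deriv \<alpha> \<beta> (cis x)) - ln (moebius_deriv \<gamma> \<delta> (cis x))"
    by (rule vertex_sides[OF P fin x(2,3) z[unfolded x(1)]]) (rule that; assumption)
  define J where "J = \<bar>ln (moebius_deriv \<alpha> \<beta> (cis x)) - ln (moebius_deriv \<gamma> \<delta> (cis x))\<bar>"
  have "J = 0"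
  proof (rule ccontr)
    assume "J \<noteq> 0"
    then have J: "J > 0" by (simp add: J_def)
    have cont: "isCont (\<lambda>t. ln (moebius_deriv a b (cis t))) x" if "(norm a)\<^sup>2 - (norm b)\<^sup>2 = 1" for a b
      using lipschitz_on_continuous_on[OF ln_moebius_deriv_lipschitz[OF that]] by (simp add: continuous_on_eq_continuous_at)
    obtain d1 where d1: "d1 > 0" "\<And>t. \<bar>t - x\<bar> < d1 \<Longrightarrow> \<bar>ln (moebius_deriv \<alpha> \<beta> (cis t)) - ln (moebius_deriv \<alpha> \<beta> (cis x))\<bar> < J / 4"
      using cont[OF R(1)] J unfolding continuous_at_eps_delta dist_real_def
      by (meson divide_pos_pos zero_less_numeral)
    obtain d2 where d2: "d2 > 0" "\<And>t. \<bar>t - x\<bar> < d2 \<Longrightarrow> \<bar>ln (moebius_deriv \<gamma> \<delta> (cis t)) - ln (moebius_deriv \<gamma> \<delta> (cis x))\<bar> < J / 4"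
      using cont[OF L(1)] J unfolding continuous_at_eps_delta dist_real_def
      by (meson divide_pos_pos zero_less_numeral)
    \<comment> \<open>The radius keeps both local formulas valid and each logarithm within
      \<open>J / 4\<close> of its one-sided value, so a difference of at least \<open>J / 2\<close>
      survives. The last two entries keep the points in the parameter interval; for
      \<open>x = 0\<close> the left side is moved by a full turn instead.\<close>
    define S where "S = {\<epsilon> / 2, d1 / 2, d2 / 2, 1, 2 * pi - x, if x = 0 then 1 else x}"
    define \<eta> where "\<eta> = Min S"
    have fS: "finite S" "S \<noteq> {}" by (simp_all add: S_def)
    have "\<forall>k\<in>S. 0 < k" using e d1(1) d2(1) x by (simp add: S_def)
    then have \<eta>0: "0 < \<eta>" unfolding \<eta>_def Min_gr_iff[OF fS] .
    have "\<eta> \<le> k" if "k \<in> S" for k unfolding \<eta>_def using fS(1) that by (rule Min_le)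
    then have "\<eta> \<le> \<epsilon> / 2" "\<eta> \<le> d1 / 2" "\<eta> \<le> d2 / 2" and \<eta>1: "\<eta> \<le> 1" "\<eta> \<le> 2 * pi - x"
      and "\<eta> \<le> (if x = 0 then 1 else x)" unfolding S_def by blast+
    then have \<eta>: "0 < \<eta>" "\<eta> < \<epsilon>" "\<eta> < d1" "\<eta> < d2" "\<eta> \<le> 1" "\<eta> \<le> 2 * pi - x" "x \<noteq> 0 \<Longrightarrow> \<eta> \<le> x"
      using \<eta>0 \<eta>1 by simp_all
    have "\<not> H_half (\<lambda>\<zeta>. ln (arc_deriv h \<zeta>))"
    proof (rule not_H_half_jump[where c = "J / 2" and \<eta> = \<eta> and ?x0.0 = x and \<tau> = "if x = 0 then 2 * pi else 0"])
      fix s t assume s: "x < s" "s \<le> x + \<eta>" and t: "x - \<eta> \<le> t" "t < x"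
      have "arc_deriv h (cis s) = moebius_deriv \<alpha> \<beta> (cis s)"
        by (rule has_arc_derivative_interior(2)[OF R]) (use s \<eta> in auto)
      moreover have "arc_deriv h (cis t) = moebius_deriv \<gamma> \<delta> (cis t)"
        by (rule has_arc_derivative_interior(2)[OF L]) (use t \<eta> in auto)
      moreover have "\<bar>ln (moebius_deriv \<alpha> \<beta> (cis s)) - ln (moebius_deriv \<alpha> \<beta> (cis x))\<bar> < J / 4"
        by (rule d1(2)) (use s \<eta> in auto)
      moreover have "\<bar>ln (moebius_deriv \<gamma> \<delta> (cis t)) - ln (moebius_deriv \<gamma> \<delta> (cis x))\<bar> < J / 4"
        by (rule d2(2)) (use t \<eta> in auto)
      ultimately show "J / 2 \<le> \<bar>ln (arc_deriv h (cis s)) - ln (arc_deriv h (cis t))\<bar>"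
        unfolding J_def by (simp add: abs_if split: if_splits)
    qed (use J \<eta> x pi_gt3 in auto)
    then show False using W by (simp add: weil_petersson_def)
  qed
  then show "(\<Sum>e\<in>{e \<in> fan z. shear h e \<noteq> 0}. shear h e) = 0"
    using S unfolding x(1) J_def by simp
qed

lemma balanced_imp_C11:
  assumes P: "Moebius_chain h (- (2 * pi)) (4 * pi)" and fin: "finite {e \<in> farey_edges. shear h e \<noteq> 0}"
    and B: "finite_balanced (shear h)"
  shows "C11_homeo h"
proof -
  have ex: "\<exists>d>0. has_arc_derivative h d \<zeta>" if n: "norm \<zeta> = 1" for \<zeta>
  proof -
    obtain x where x: "\<zeta> = cis x" "0 \<le> x" "x < 2 * pi" using cis_lift[OF n, of 0] by auto
    show ?thesis
    proof (cases "\<zeta> \<in> farey_vertices")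
      case True
      obtain \<epsilon> \<alpha> \<beta> \<gamma> \<delta> where e: "\<epsilon> > 0" and R: "(norm \<alpha>)\<^sup>2 - (norm \<beta>)\<^sup>2 = 1"
        "\<And>y. y \<in> {x..x + \<epsilon>} \<Longrightarrow> h (cis y) = moebius \<alpha> \<beta> (cis y)"
        and L: "(norm \<gamma>)\<^sup>2 - (norm \<delta>)\<^sup>2 = 1" "\<And>y. y \<in> {x - \<epsilon>..x} \<Longrightarrow> h (cis y) = moebius \<gamma> \<delta> (cis y)"
        and S: "(\<Sum>e\<in>{e \<in> fan (cis x). shear h e \<noteq> 0}. shear h e) = ln (moebius_deriv \<alpha> \<beta> (cis x)) - ln (moebius_deriv \<gamma> \<delta> (cis x))"
        by (rule vertex_sides[OF P fin x(2,3) True[unfolded x(1)]]) (rule that; assumption)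
      \<comment> \<open>The balanced condition makes the jump vanish; positivity then allows the
        logarithms to be removed.\<close>
      have "ln (moebius_deriv \<alpha> \<beta> (cis x)) = ln (moebius_deriv \<gamma> \<delta> (cis x))"
        using S B True unfolding finite_balanced_def x(1) by simp
      then have "moebius_deriv \<alpha> \<beta> (cis x) = moebius_deriv \<gamma> \<delta> (cis x)"
        using moebius_deriv_pos[OF R(1), of "cis x"] moebius_deriv_pos[OF L(1), of "cis x"] by simp
      from has_arc_derivative_glue[OF R L e this] show ?thesis
        using moebius_deriv_pos[OF R(1), of "cis x"] x(1) by auto
    next
      case False
      then obtain c d g where g: "g \<in> PSU11" "c < x" "x < d" "\<And>y. y \<in> {c..d} \<Longrightarrow> h (cis y) = g (cis y)"
        using Moebius_chain_nonvertex[OF P, of x] x by (auto simp: add_pos_nonneg)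
      obtain \<alpha> \<beta> where ab: "(norm \<alpha>)\<^sup>2 - (norm \<beta>)\<^sup>2 = 1" "g = moebius \<alpha> \<beta>" using PSU11_moebius[OF g(1)] .
      have "has_arc_derivative h (moebius_deriv \<alpha> \<beta> (cis x)) (cis x)"
        by (rule has_arc_derivative_interior(1)[OF ab(1), of c d]) (use g ab in auto)
      then show ?thesis using moebius_deriv_pos[OF ab(1), of "cis x"] x(1) by auto
    qed
  qed
  then have "\<exists>d. has_arc_derivative h d (cis x)" for x by (metis norm_cis)
  then obtain L where "L-lipschitz_on {- (2 * pi)..4 * pi} (\<lambda>x. ln (arc_deriv h (cis x)))"
    using Moebius_chain_lipschitz[OF P] by blast
  then have "(3 * L)-lipschitz_on unit_circle (\<lambda>\<zeta>. ln (arc_deriv h \<zeta>))" by (rule circle_lipschitz)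
  then show ?thesis using ex homeo by (auto simp: C11_homeo_def)
qed

end

theorem lemma3p4:
  fixes h :: "complex \<Rightarrow> complex"
  assumes "circle_homeo h" and "orientation_preserving h"
    and "h (-1) = -1" and "h \<i> = \<i>" and "h 1 = 1"
    and "finite {e \<in> farey_edges. shear h e \<noteq> 0}"
  shows "(weil_petersson h \<longleftrightarrow> C11_homeo h \<and> piecewise_Moebius farey_vertices h) \<and>
         (C11_homeo h \<and> piecewise_Moebius farey_vertices h \<longleftrightarrow> finite_balanced (shear h))"
proof -
  interpret oriented_circle_homeo h using assms by unfold_locales
  have P: "Moebius_chain h 0 (2 * pi)" by (rule finite_shears_Moebius_chain[OF assms(6)])
  \<comment> \<open>With finitely many nonzero shears the breakpoints are rational, so (ii) amounts
    to \<open>C11_homeo h\<close>, and the three implications close a cycle.\<close>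
  have pM: "piecewise_Moebius farey_vertices h" using Moebius_chain_piecewise_Moebius[of h 0] P by simp
  \<comment> \<open>One turn of the chain is copied before and after the original one, as needed by
    \<open>vertex_sides\<close> and \<open>circle_lipschitz\<close>.\<close>
  have "Moebius_chain h (- (2 * pi)) 0" using Moebius_chain_shift[OF P, of "- (2 * pi)"] by (simp flip: cis_cnj)
  moreover have "Moebius_chain h (2 * pi) (4 * pi)" using Moebius_chain_shift[OF P, of "2 * pi"] by simp
  ultimately have "Moebius_chain h (- (2 * pi)) (4 * pi)" using P Moebius_chain.join by metis
  then show ?thesis
    using pM C11_imp_weil_petersson weil_petersson_imp_balanced balanced_imp_C11 assms(6) by metis
qed

end
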